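(* For $0<t<T$, the price $B_t^T=P_t^T\,\mathbb{E}[Z_T\mid \mathcal{F}_t^{\zeta^T}]$ of the cash flow $Z_T$ is given, $\mathbb{P}$-a.s., by $$B_t^T=P_t^T\,Z_T\,\mathbb{I}_{\{\nu\le t\}}+P_t^T\sum_{i=1}^{l}z_i\,\frac{\displaystyle\int_{t}^{T}\varphi_{t}^{r,z_i}(\zeta^T_t)f(r,z_i)\,\mathrm{d}r+F(T,z_i)\,\varphi_{t}^{T,z_i}(\zeta^T_t)}{\displaystyle\sum_{j=1}^{l}\Big[\int_{t}^{T}\varphi_{t}^{r,z_j}(\zeta^T_t)f(r,z_j)\,\mathrm{d}r+F(T,z_j)\,\varphi_{t}^{T,z_j}(\zeta^T_t)\Big]p_j}\,p_i\,\mathbb{I}_{\{t<\nu\}}.$$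
   Context: Let $T>0$ and $\sigma>0$ be constants. On a complete probability space $(\Omega,\mathcal{F},\mathbb{P})$ let $W=(W_t)_{t\ge 0}$ be a standard Brownian motion, $\tau$ a strictly positive random time and $Z_T$ a real random variable, such that $W$ is independent of the pair $(\tau,Z_T)$ ($\tau$ and $Z_T$ need not be independent of each other). $Z_T$ takes values in a finite set $\{z_1,\dots,z_l\}$ of distinct reals, with $\mathbb{P}(Z_T=z_i)=p_i>0$, $\sum_i p_i=1$. Assume $\mathbb{P}(\tau\le T)<1$ and that for each $i$ the conditional law of $\tau$ given $Z_T=z_i$ has a continuous density $f(\cdot,z_i)$ with respect to Lebesgue measure on $\mathbb{R}_+$. Put $F(T,z_i)=\int_T^{+\infty}f(r,z_i)\,\mathrm{d}r$ and $\nu=\tau\wedge T$. The market information process is $$\zeta^T_t=W_{t\wedge \nu}-\frac{t\wedge \nu}{\nu}W_{\nu}+\sigma\frac{t\wedge \nu}{\nu}Z_T,\qquad t\in[0,T],$$ and $\mathbb{F}^{\zeta^T}=(\mathcal{F}^{\zeta^T}_t)_{0\le t\le T}$ is its natural filtration completed by the $\mathbb{P}$-null sets. The short rate $\rho$ is deterministic and $P_t^T=\exp\big(-\int_t^T\rho(u)\,\mathrm{d}u\big)$ is the time-$t$ value of the default-free bond maturing at $T$. $p(t,x,y)=\frac{1}{\sqrt{2\pi t}}e^{-(x-y)^2/(2t)}$ is the Gaussian density in $x$ with variance $t$ and mean $y$, and $\varphi_{t}^{r,z}(x)=p\big(\frac{t(r-t)}{r},x,\frac{t}{r}\sigma z\big)$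 for $0<t<r$. *)

theory Defs
  imports "HOL-Probability.Probability"
begin

text \<open>
  Only times \<open>t \<ge> 0\<close> matter. Starting at 0 and path continuity are required almost surely.
\<close>

definition standard_brownian_motion :: "'a measure \<Rightarrow> (real \<Rightarrow> 'a \<Rightarrow> real) \<Rightarrow> bool" where
  "standard_brownian_motion M W \<longleftrightarrow>
     (\<forall>t\<ge>0. W t \<in> borel_measurable M) \<and>
     (AE \<omega> in M. W 0 \<omega> = 0) \<and>
     (AE \<omega> in M. continuous_on {0..} (\<lambda>t. W t \<omega>)) \<and>
     (\<forall>s t. 0 \<le> s \<and> s < t \<longrightarrow>
        distributed M lborel (\<lambda>\<omega>. W t \<omega> - W s \<omega>) (normal_density 0 (sqrt (t - s)))) \<and>
     (\<forall>u n. 0 \<le> u 0 \<and> incseq u \<longrightarrow>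
        prob_space.indep_vars M (\<lambda>_::nat. borel) (\<lambda>i \<omega>. W (u (Suc i)) \<omega> - W (u i) \<omega>) {..<n})"

definition process_events :: "'a measure \<Rightarrow> real set \<Rightarrow> (real \<Rightarrow> 'a \<Rightarrow> real) \<Rightarrow> 'a set set" where
  "process_events M I X = {X s -` A \<inter> space M | s A. s \<in> I \<and> A \<in> sets borel}"

definition completed_natural_filtration ::
    "'a measure \<Rightarrow> (real \<Rightarrow> 'a \<Rightarrow> real) \<Rightarrow> real \<Rightarrow> 'a measure" where
  "completed_natural_filtration M X t = sigma (space M) (process_events M {0..t} X \<union> null_sets M)"

text \<open>
  Independence of a real process, through the sigma-algebra generated by all its values at
  times in \<open>I\<close>, from a real random vector \<open>(Y, Z)\<close>. The library constant \<open>indep_var\<close> needs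
  both variables to have the same range type, hence the formulation by sigma-algebras.
\<close>

definition process_indep_of_pair ::
    "'a measure \<Rightarrow> real set \<Rightarrow> (real \<Rightarrow> 'a \<Rightarrow> real) \<Rightarrow> ('a \<Rightarrow> real) \<Rightarrow> ('a \<Rightarrow> real) \<Rightarrow> bool" where
  "process_indep_of_pair M I X Y Z \<longleftrightarrow>
     prob_space.indep_set M
       (sigma_sets (space M) (process_events M I X))
       (sets (vimage_algebra (space M) (\<lambda>\<omega>. (Y \<omega>, Z \<omega>)) borel))"

definition information_process ::
    "real \<Rightarrow> (real \<Rightarrow> 'a \<Rightarrow> real) \<Rightarrow> ('a \<Rightarrow> real) \<Rightarrow> ('a \<Rightarrow> real) \<Rightarrow> real \<Rightarrow> 'a \<Rightarrow> real" where
  "information_process \<sigma> W \<nu> Z t \<omega> =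
     W (min t (\<nu> \<omega>)) \<omega> - min t (\<nu> \<omega>) / \<nu> \<omega> * W (\<nu> \<omega>) \<omega> + \<sigma> * (min t (\<nu> \<omega>) / \<nu> \<omega>) * Z \<omega>"

definition bond_price :: "(real \<Rightarrow> real) \<Rightarrow> real \<Rightarrow> real \<Rightarrow> real" where
  "bond_price \<rho> t T = exp (- (LBINT u:{t..T}. \<rho> u))"

text \<open>
  The second argument of \<open>normal_density\<close> is the standard deviation, so the Gaussian density
  below has variance \<open>t * (r - t) / r\<close>. It is meant for \<open>0 < t < r\<close>.
\<close>

definition bridge_density :: "real \<Rightarrow> real \<Rightarrow> real \<Rightarrow> real \<Rightarrow> real \<Rightarrow> real" where
  "bridge_density \<sigma> t r z x = normal_density (t / r * \<sigma> * z) (sqrt (t * (r - t) / r)) x"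

definition tail_integral :: "(real \<Rightarrow> real \<Rightarrow> real) \<Rightarrow> real \<Rightarrow> real \<Rightarrow> real" where
  "tail_integral f T z = (LBINT r:{T..}. f r z)"

end

theory Submission
  imports Defs
begin

text \<open>
  Before the default time \<open>\<nu>\<close> the information process is determined by its current value and by the
  Brownian bridge on \<open>[0, t]\<close>: for \<open>s \<le> t < \<nu>\<close> one has
  \<open>\<zeta> s = s / t * \<zeta> t + (W s - s / t * W t)\<close>. The bridge \<open>W s - s / t * W t\<close>, \<open>s \<le> t\<close>, is independent of
  \<open>(\<tau>, Z)\<close> and, for every fixed \<open>r > t\<close>, of \<open>W t - t / r * W r\<close>; hence on \<open>t < \<nu>\<close> conditioning on the whole past
  amounts to conditioning on \<open>\<zeta> t\<close>, and Bayes' formula for the joint law of \<open>(Z, \<zeta> t)\<close> gives the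
  weights. From the default time on, \<open>\<zeta> t = \<sigma> * Z\<close>, while before it \<open>\<zeta> t\<close> almost surely avoids the
  finitely many values \<open>\<sigma> * z i\<close>, so that \<open>\<zeta> t\<close> alone tells the two cases apart.
\<close>

section \<open>Regression of Gaussian variables\<close>

text \<open>The obstacle is that the bridge is pinned at the random time \<open>\<nu>\<close>, so
  that \<open>W\<close> is evaluated at a random place. Independence is therefore used as a product
  law of the path and the pair: once all paths are continuous,
  \<open>W (\<nu> \<omega>) \<omega>\<close> is jointly measurable, the pair can be frozen, and only
  deterministic pinning times \<open>r\<close> remain. For these all Gaussian facts come from one
  planar change of variables, which splits \<open>X\<close> into its regression on
  \<open>X + D\<close> and an independent residual. It serves both for the independence of the
  bridge from its endpoint, by induction over finitely many times, and for the law of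
  \<open>W t - t / r * W r\<close>. The mass of a past bridge event is then the same factor for
  every \<open>r\<close> and every \<open>z i\<close>, so it cancels in Bayes' formula. The
  conditional expectation is verified through the error \<open>Z - filtered (\<zeta> t)\<close>, cut
  off at default: its integral over an event of the filtration depends only on the trace of the
  event on \<open>t < \<nu>\<close>, and there the generators of the filtration can be traded for
  events of the bridge and of \<open>\<zeta> t\<close>.\<close>

lemma normal_density_rotation:
  assumes "0 < a" "0 < b"
  defines "c \<equiv> a / (a + b)"
  shows "normal_density 0 (sqrt a) (u + c * v) * normal_density 0 (sqrt b) (v - (u + c * v)) =
    normal_density 0 (sqrt (a * b / (a + b))) u * normal_density 0 (sqrt (a + b)) v"
proof -
  \<comment> \<open>The cross terms in \<open>u * v\<close> cancel: \<open>c\<close> is the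
    regression coefficient of \<open>X\<close> on \<open>X + D\<close> for variances
    \<open>a\<close> and \<open>b\<close>, and the residual variance \<open>a - c * a\<close> is
    \<open>a * b / (a + b)\<close>.\<close>
  have e: "- (u + c * v)\<^sup>2 / (2 * a) + - (v - (u + c * v))\<^sup>2 / (2 * b) =
      - u\<^sup>2 / (2 * (a * b / (a + b))) + - v\<^sup>2 / (2 * (a + b))"
    using assms(1,2) unfolding c_def
    by (simp add: divide_simps power2_eq_square) (simp add: algebra_simps)
  have s: "1 / sqrt (2 * pi * a) * (1 / sqrt (2 * pi * b)) =
      1 / sqrt (2 * pi * (a * b / (a + b))) * (1 / sqrt (2 * pi * (a + b)))"
    using assms(1,2) by (simp add: real_sqrt_mult[symmetric] field_simps)
  have "normal_density 0 (sqrt a) (u + c * v) * normal_density 0 (sqrt b) (v - (u + c * v)) =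
     (1 / sqrt (2 * pi * a) * (1 / sqrt (2 * pi * b))) *
     exp (- (u + c * v)\<^sup>2 / (2 * a) + - (v - (u + c * v))\<^sup>2 / (2 * b))"
    unfolding exp_add using assms(1,2) by (simp add: normal_density_def)
  also have "\<dots> = normal_density 0 (sqrt (a * b / (a + b))) u * normal_density 0 (sqrt (a + b)) v"
    unfolding e s exp_add using assms(1,2) by (simp add: normal_density_def)
  finally show ?thesis .
qed

text \<open>The change of variables is a product of two shears, so two one-dimensional translations,
  \<open>v = x + d\<close> and then \<open>x = c * v + u\<close>, with Fubini in between replace a
  Jacobian in the plane.\<close>

lemma nn_integral_normal_rotation:
  fixes h :: "real \<times> real \<Rightarrow> ennreal"
  assumes [measurable]: "h \<in> borel_measurable borel" and ab: "0 < a" "0 < b"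
  defines "c \<equiv> a / (a + b)"
  shows "(\<integral>\<^sup>+x. (\<integral>\<^sup>+d. h (x - c * (x + d), x + d) * normal_density 0 (sqrt b) d \<partial>lborel)
            * normal_density 0 (sqrt a) x \<partial>lborel) =
    (\<integral>\<^sup>+v. (\<integral>\<^sup>+u. h (u, v) * normal_density 0 (sqrt (a * b / (a + b))) u \<partial>lborel)
            * normal_density 0 (sqrt (a + b)) v \<partial>lborel)"
proof -
  have "(\<integral>\<^sup>+x. (\<integral>\<^sup>+d. h (x - c * (x + d), x + d) * normal_density 0 (sqrt b) d \<partial>lborel)
            * normal_density 0 (sqrt a) x \<partial>lborel)
     = (\<integral>\<^sup>+x. (\<integral>\<^sup>+v. h (x - c * v, v) * normal_density 0 (sqrt b) (v - x)
            * normal_density 0 (sqrt a) x \<partial>lborel) \<partial>lborel)"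
  proof (intro nn_integral_cong)
    fix x :: real
    show "(\<integral>\<^sup>+d. h (x - c * (x + d), x + d) * normal_density 0 (sqrt b) d \<partial>lborel)
            * normal_density 0 (sqrt a) x =
      (\<integral>\<^sup>+v. h (x - c * v, v) * normal_density 0 (sqrt b) (v - x)
            * normal_density 0 (sqrt a) x \<partial>lborel)"
      by (subst nn_integral_multc[symmetric], measurable,
          subst (2) nn_integral_real_affine[where c=1 and t=x]) (simp_all add: algebra_simps)
  qed
  also have "\<dots> = (\<integral>\<^sup>+v. (\<integral>\<^sup>+x. h (x - c * v, v) * normal_density 0 (sqrt b) (v - x)
            * normal_density 0 (sqrt a) x \<partial>lborel) \<partial>lborel)"
    by (rule lborel_pair.Fubini') simp
  also have "\<dots> = (\<integral>\<^sup>+v. (\<integral>\<^sup>+u. h (u, v) * normal_density 0 (sqrt (a * b / (a + b))) u \<partial>lborel)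
            * normal_density 0 (sqrt (a + b)) v \<partial>lborel)"
  proof (intro nn_integral_cong)
    fix v :: real
    have *: "ennreal (normal_density 0 (sqrt b) (v - (c * v + u))) * normal_density 0 (sqrt a) (c * v + u)
      = ennreal (normal_density 0 (sqrt (a * b / (a + b))) u) * ennreal (normal_density 0 (sqrt (a + b)) v)" for u
      using normal_density_rotation[OF ab, of u v]
      by (simp add: c_def ennreal_mult[symmetric] ac_simps)
    show "(\<integral>\<^sup>+x. h (x - c * v, v) * normal_density 0 (sqrt b) (v - x)
            * normal_density 0 (sqrt a) x \<partial>lborel) =
      (\<integral>\<^sup>+u. h (u, v) * normal_density 0 (sqrt (a * b / (a + b))) u \<partial>lborel)
            * normal_density 0 (sqrt (a + b)) v"
      by (subst nn_integral_real_affine[where c=1 and t="c * v"])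
         (simp_all add: mult.assoc * nn_integral_multc[symmetric])
  qed
  finally show ?thesis .
qed

text \<open>
  \<open>c * (X + D)\<close> is the regression of \<open>X\<close> on \<open>X + D\<close>; the event \<open>\<Gamma>\<close> stands for information independent
  of both \<open>X\<close> and \<open>D\<close>.
\<close>

lemma (in prob_space) gaussian_regression_residual:
  assumes \<Gamma> [measurable]: "\<Gamma> \<in> events"
    and X: "distributed M lborel X (normal_density 0 (sqrt a))"
    and D: "distributed M lborel D (normal_density 0 (sqrt b))"
    and ab: "0 < a" "0 < b"
    and ind: "\<And>E F. E \<in> sets borel \<Longrightarrow> F \<in> sets borel \<Longrightarrow>
      emeasure M (\<Gamma> \<inter> (X -` E \<inter> D -` F \<inter> space M)) =
        emeasure M \<Gamma> * emeasure M (X -` E \<inter> space M) * emeasure M (D -` F \<inter> space M)"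
    and [measurable]: "A \<in> sets borel" "B \<in> sets borel"
  defines "c \<equiv> a / (a + b)"
  shows "emeasure M (\<Gamma> \<inter> {\<omega> \<in> space M. X \<omega> - c * (X \<omega> + D \<omega>) \<in> A \<and> X \<omega> + D \<omega> \<in> B}) =
    emeasure M \<Gamma> * (\<integral>\<^sup>+u\<in>A. normal_density 0 (sqrt (a * b / (a + b))) u \<partial>lborel)
      * (\<integral>\<^sup>+v\<in>B. normal_density 0 (sqrt (a + b)) v \<partial>lborel)"
proof -
  have [measurable]: "X \<in> borel_measurable M" "D \<in> borel_measurable M"
    using X D by (simp_all add: distributed_def)
  \<comment> \<open>Restricting \<open>M\<close> to \<open>\<Gamma>\<close> turns \<open>ind\<close>
    into a product law for \<open>(X, D)\<close>. The mass of \<open>\<Gamma>\<close> is put on the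
    first factor, so that the second one remains a probability measure.\<close>
  let ?G = "density M (indicator \<Gamma>)"
  let ?M1 = "density lborel (\<lambda>x. emeasure M \<Gamma> * normal_density 0 (sqrt a) x)"
  let ?M2 = "density lborel (normal_density 0 (sqrt b))"
  let ?h = "\<lambda>p::real \<times> real. indicator (A \<times> B) p :: ennreal"
  have [measurable]: "?h \<in> borel_measurable borel"
    by (intro borel_measurable_indicator) (simp add: borel_prod[symmetric])
  have mX: "emeasure M (X -` E \<inter> space M) = (\<integral>\<^sup>+x\<in>E. normal_density 0 (sqrt a) x \<partial>lborel)"
    if "E \<in> sets borel" for E
    using distributed_emeasure[OF X, of E] that by simp
  have mD: "emeasure M (D -` E \<inter> space M) = (\<integral>\<^sup>+x\<in>E. normal_density 0 (sqrt b) x \<partial>lborel)"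
    if "E \<in> sets borel" for E
    using distributed_emeasure[OF D, of E] that by simp
  have "prob_space ?M2"
    using D prob_space_distr[of D lborel] by (simp add: distributed_def)
  then have s2: "sigma_finite_measure ?M2"
    by (simp add: prob_space_imp_sigma_finite)
  have "prob_space (density lborel (normal_density 0 (sqrt a)))"
    using X prob_space_distr[of X lborel] by (simp add: distributed_def)
  from prob_space.emeasure_space_1[OF this]
  have "emeasure ?M1 (space ?M1) = emeasure M \<Gamma>"
    by (simp add: emeasure_density nn_integral_cmult)
  then have s1: "sigma_finite_measure ?M1"
    by (intro finite_measure.sigma_finite_measure finite_measureI) simp
  have eq: "?M1 \<Otimes>\<^sub>M ?M2 = distr ?G (borel \<Otimes>\<^sub>M borel) (\<lambda>\<omega>. (X \<omega>, D \<omega>))"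
  proof (rule pair_measure_eqI[OF s1 s2])
    show "sets (?M1 \<Otimes>\<^sub>M ?M2) = sets (distr ?G (borel \<Otimes>\<^sub>M borel) (\<lambda>\<omega>. (X \<omega>, D \<omega>)))"
      by simp
    fix E F assume "E \<in> sets ?M1" "F \<in> sets ?M2"
    then have [measurable]: "E \<in> sets borel" "F \<in> sets borel" by auto
    have "emeasure ?M1 E * emeasure ?M2 F =
        emeasure M \<Gamma> * emeasure M (X -` E \<inter> space M) * emeasure M (D -` F \<inter> space M)"
      by (simp add: emeasure_density mX mD mult.assoc nn_integral_cmult)
    also have "\<dots> = emeasure M (\<Gamma> \<inter> (X -` E \<inter> D -` F \<inter> space M))"
      by (rule ind[symmetric]) auto
    also have "\<dots> = emeasure (distr ?G (borel \<Otimes>\<^sub>M borel) (\<lambda>\<omega>. (X \<omega>, D \<omega>))) (E \<times> F)"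
      by (subst emeasure_distr, measurable, simp, subst emeasure_restricted)
         (auto intro!: arg_cong[where f="emeasure M"])
    finally show "emeasure ?M1 E * emeasure ?M2 F =
      emeasure (distr ?G (borel \<Otimes>\<^sub>M borel) (\<lambda>\<omega>. (X \<omega>, D \<omega>))) (E \<times> F)" .
  qed
  interpret M2: sigma_finite_measure ?M2 by (rule s2)
  let ?k = "\<lambda>(x, d). ?h (x - c * (x + d), x + d)"
  have k[measurable]: "?k \<in> borel_measurable (borel \<Otimes>\<^sub>M borel)" by measurable
  have k'[measurable]: "?k \<in> borel_measurable (?M1 \<Otimes>\<^sub>M ?M2)"
    by (simp cong: measurable_cong_sets sets_pair_measure_cong)
  have "emeasure M (\<Gamma> \<inter> {\<omega> \<in> space M. X \<omega> - c * (X \<omega> + D \<omega>) \<in> A \<and> X \<omega> + D \<omega> \<in> B}) =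
     (\<integral>\<^sup>+p. ?k p \<partial>distr ?G (borel \<Otimes>\<^sub>M borel) (\<lambda>\<omega>. (X \<omega>, D \<omega>)))"
    by (subst nn_integral_distr)
       (auto simp: nn_integral_density nn_integral_indicator[symmetric] simp del: nn_integral_indicator
           intro!: nn_integral_cong split: split_indicator)
  also have "\<dots> = (\<integral>\<^sup>+x. \<integral>\<^sup>+d. ?k (x, d) \<partial>?M2 \<partial>?M1)"
    unfolding eq[symmetric] by (rule M2.nn_integral_fst[symmetric, OF k'])
  also have "\<dots> = (\<integral>\<^sup>+x. emeasure M \<Gamma> * ((\<integral>\<^sup>+d. ?h (x - c * (x + d), x + d)
       * normal_density 0 (sqrt b) d \<partial>lborel) * normal_density 0 (sqrt a) x) \<partial>lborel)"
    by (simp add: nn_integral_density ac_simps)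
  also have "\<dots> = emeasure M \<Gamma> * (\<integral>\<^sup>+x. (\<integral>\<^sup>+d. ?h (x - c * (x + d), x + d)
       * normal_density 0 (sqrt b) d \<partial>lborel) * normal_density 0 (sqrt a) x \<partial>lborel)"
    by (intro nn_integral_cmult) measurable
  also have "\<dots> = emeasure M \<Gamma> * (\<integral>\<^sup>+v. (\<integral>\<^sup>+u. ?h (u, v) * normal_density 0 (sqrt (a * b / (a + b))) u \<partial>lborel)
            * normal_density 0 (sqrt (a + b)) v \<partial>lborel)"
    unfolding c_def by (subst nn_integral_normal_rotation[OF _ ab]) simp_all
  also have "(\<lambda>v. (\<integral>\<^sup>+u. ?h (u, v) * normal_density 0 (sqrt (a * b / (a + b))) u \<partial>lborel)
            * normal_density 0 (sqrt (a + b)) v) =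
     (\<lambda>v. (\<integral>\<^sup>+u\<in>A. normal_density 0 (sqrt (a * b / (a + b))) u \<partial>lborel) *
       (ennreal (normal_density 0 (sqrt (a + b)) v) * indicator B v))"
    by (auto simp: fun_eq_iff indicator_times ac_simps split: split_indicator)
  also have "(\<integral>\<^sup>+v. (\<integral>\<^sup>+u\<in>A. normal_density 0 (sqrt (a * b / (a + b))) u \<partial>lborel) *
       (ennreal (normal_density 0 (sqrt (a + b)) v) * indicator B v) \<partial>lborel) =
     (\<integral>\<^sup>+u\<in>A. normal_density 0 (sqrt (a * b / (a + b))) u \<partial>lborel) *
     (\<integral>\<^sup>+v\<in>B. normal_density 0 (sqrt (a + b)) v \<partial>lborel)"
    by (intro nn_integral_cmult) measurable
  finally show ?thesis by (simp add: mult.assoc)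
qed

section \<open>Independence properties of Brownian motion\<close>

lemma process_events_subset_sets:
  "(\<And>s. s \<in> I \<Longrightarrow> X s \<in> borel_measurable M) \<Longrightarrow> process_events M I X \<subseteq> sets M"
  by (auto simp: process_events_def)

lemma process_eventsI:
  "s \<in> I \<Longrightarrow> A \<in> sets borel \<Longrightarrow> X s -` A \<inter> space M \<in> process_events M I X"
  unfolding process_events_def by blast

lemma process_events_mono: "I \<subseteq> J \<Longrightarrow> process_events M I X \<subseteq> process_events M J X"
  by (auto simp: process_events_def)

lemma process_events_Pow: "process_events M I X \<subseteq> Pow (space M)"
  by (auto simp: process_events_def)

lemma process_events_subset_sigma:
  assumes "\<And>s. s \<in> I \<Longrightarrow> X s \<in> borel_measurable (sigma (space M) K)" "K \<subseteq> Pow (space M)"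
  shows "sigma_sets (space M) (process_events M I X) \<subseteq> sigma_sets (space M) K"
proof (rule sigma_sets_mono)
  have "X s -` A \<inter> space M \<in> sigma_sets (space M) K" if "s \<in> I" "A \<in> sets borel" for s A
    using measurable_sets[OF assms(1)[OF that(1)] that(2)] assms(2) by (simp add: space_measure_of_conv)
  then show "process_events M I X \<subseteq> sigma_sets (space M) K"
    by (auto simp: process_events_def)
qed

lemma measurable_process_events:
  assumes "s \<in> I" "sigma_sets (space M) (process_events M I X) \<subseteq> sigma_sets (space M) K"
    and "K \<subseteq> Pow (space M)"
  shows "X s \<in> borel_measurable (sigma (space M) K)"
proof (rule measurableI)
  fix A :: "real set" assume "A \<in> sets borel"
  with assms(1) have "X s -` A \<inter> space M \<in> process_events M I X"
    by (rule process_eventsI)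
  with assms(2,3) show "X s -` A \<inter> space (sigma (space M) K) \<in> sets (sigma (space M) K)"
    by (auto simp: space_measure_of_conv)
qed simp

lemma (in prob_space) indep_set_mono:
  "indep_set A B \<Longrightarrow> A' \<subseteq> A \<Longrightarrow> B' \<subseteq> B \<Longrightarrow> indep_set A' B'"
  unfolding indep_sets2_eq by blast

text \<open>Events that depend on finitely many times form an intersection-stable generator, because
  two finite index sets have a finite union; independence passes from intersection-stable generators
  to the generated sigma-algebras.\<close>

lemma (in prob_space) indep_set_process_events_finite:
  assumes fin: "\<And>J. finite J \<Longrightarrow> J \<subseteq> I \<Longrightarrow>
      indep_set (sigma_sets (space M) (process_events M J X)) D"
    and D: "Int_stable D"
  shows "indep_set (sigma_sets (space M) (process_events M I X)) D"
proof -
  let ?S = "\<lambda>J. sigma_sets (space M) (process_events M J X)"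
  let ?U = "\<Union>J\<in>{J. finite J \<and> J \<subseteq> I}. ?S J"
  have "indep_set ?U D"
  proof (rule indep_setI)
    show "?U \<subseteq> events" "D \<subseteq> events"
      using indep_setD_ev1[OF fin] indep_setD_ev2[OF fin[of "{}"]] by blast+
    show "prob (a \<inter> b) = prob a * prob b" if "a \<in> ?U" "b \<in> D" for a b
      using that by (auto intro: indep_setD[OF fin])
  qed
  moreover have "Int_stable ?U"
  proof (rule Int_stableI)
    fix a b assume "a \<in> ?U" "b \<in> ?U"
    then obtain J K where JK: "finite J" "J \<subseteq> I" "a \<in> ?S J" "finite K" "K \<subseteq> I" "b \<in> ?S K"
      by auto
    interpret S: sigma_algebra "space M" "?S (J \<union> K)"
      by (intro sigma_algebra_sigma_sets process_events_Pow)
    have "?S J \<subseteq> ?S (J \<union> K)" "?S K \<subseteq> ?S (J \<union> K)"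
      by (intro sigma_sets_mono' process_events_mono; simp)+
    with JK have "a \<inter> b \<in> ?S (J \<union> K)" by (intro S.Int) auto
    with JK show "a \<inter> b \<in> ?U" by auto
  qed
  ultimately have ind: "indep_set (sigma_sets (space M) ?U) (sigma_sets (space M) D)"
    using D by (rule indep_set_sigma_sets)
  have "process_events M I X \<subseteq> ?U"
  proof
    fix a assume "a \<in> process_events M I X"
    then obtain s where "s \<in> I" "a \<in> process_events M {s} X"
      by (auto simp: process_events_def)
    then show "a \<in> ?U" by (intro UN_I[of "{s}"]) auto
  qed
  then have "?S I \<subseteq> sigma_sets (space M) ?U" by (rule sigma_sets_mono')
  moreover have "D \<subseteq> sigma_sets (space M) D" by auto
  ultimately show ?thesis by (rule indep_set_mono[OF ind])
qed

lemma Int_stable_vimage: "Int_stable {X -` A \<inter> S |A. A \<in> sets N}"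
proof (rule Int_stableI)
  fix a b assume "a \<in> {X -` A \<inter> S |A. A \<in> sets N}" "b \<in> {X -` A \<inter> S |A. A \<in> sets N}"
  then obtain A B where "a = X -` A \<inter> S" "A \<in> sets N" "b = X -` B \<inter> S" "B \<in> sets N" by auto
  then have "a \<inter> b = X -` (A \<inter> B) \<inter> S" "A \<inter> B \<in> sets N" by auto
  then show "a \<inter> b \<in> {X -` A \<inter> S |A. A \<in> sets N}" by blast
qed

text \<open>The times are laid out for the increments in \<open>standard_brownian_motion\<close>:
  the first \<open>n\<close> increments run from \<open>a\<close> to \<open>m\<close> and pass
  through all of \<open>J\<close>, and the increment with index \<open>n\<close> leads from
  \<open>m\<close> to \<open>t\<close>.\<close>

lemma sorted_enumeration:
  fixes J :: "real set"
  assumes "finite J" "J \<subseteq> {a..m}" "a \<le> m" "m < t"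
  obtains u :: "nat \<Rightarrow> real" and n
    where "u 0 = a" "u n = m" "u (Suc n) = t" "incseq u" "J \<subseteq> u ` {..n}"
proof -
  define S where "S = insert a (insert m J)"
  define xs where "xs = sorted_list_of_set S"
  have fin: "finite S" using assms by (simp add: S_def)
  have set: "set xs = S" and sorted: "sorted xs" using fin by (simp_all add: xs_def)
  have ne: "xs \<noteq> []" using set by (auto simp: S_def)
  define n where "n = length xs - 1"
  have len: "length xs = Suc n" using ne by (simp add: n_def)
  \<comment> \<open>Constant after \<open>n\<close>, since \<open>incseq\<close> speaks about all
    natural numbers.\<close>
  define u where "u i = (if i \<le> n then xs ! i else t)" for i
  have bound: "a \<le> x" "x \<le> m" if "x \<in> set xs" for x
    using that assms by (auto simp: set S_def)
  have mono: "xs ! i \<le> xs ! j" if "i \<le> j" "j \<le> n" for i j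
    using sorted_nth_mono[OF sorted] that len by simp
  obtain i where i: "i \<le> n" "xs ! i = a"
    using set len by (metis S_def in_set_conv_nth insertI1 less_Suc_eq_le)
  obtain j where j: "j \<le> n" "xs ! j = m"
    using set len by (metis S_def in_set_conv_nth insertI1 insertI2 less_Suc_eq_le)
  have "u 0 = a"
    using mono[of 0 i] i bound(1)[of "xs ! 0"] len by (simp add: u_def)
  moreover have "u n = m"
    using mono[of j n] j bound(2)[of "xs ! n"] len by (simp add: u_def)
  moreover have "u (Suc n) = t" by (simp add: u_def)
  moreover have "incseq u"
  proof (rule incseq_SucI)
    fix k
    show "u k \<le> u (Suc k)"
      using mono[of k "Suc k"] bound(2)[of "xs ! k"] len assms(4)
      by (force simp: u_def)
  qed
  moreover have "J \<subseteq> u ` {..n}"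
  proof
    fix x assume "x \<in> J"
    then have "x \<in> set xs" using set by (simp add: S_def)
    then obtain k where "k \<le> n" "xs ! k = x" using len by (metis in_set_conv_nth less_Suc_eq_le)
    then show "x \<in> u ` {..n}" by (intro image_eqI[of _ _ k]) (auto simp: u_def)
  qed
  ultimately show ?thesis by (rule that)
qed

text \<open>A version without exceptional paths: continuity for every \<open>\<omega>\<close> gives
  joint measurability in time and \<open>\<omega>\<close>, and the value 0 up to time 0 makes sums
  of increments telescope pointwise.\<close>

locale regular_brownian_motion = prob_space M for M :: "'a measure" +
  fixes W :: "real \<Rightarrow> 'a \<Rightarrow> real"
  assumes brownian: "standard_brownian_motion M W"
    and W_measurable [measurable]: "\<And>s. W s \<in> borel_measurable M"
    and W_continuous: "\<And>\<omega>. continuous_on UNIV (\<lambda>s. W s \<omega>)"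
    and W_nonpos: "\<And>s \<omega>. s \<le> 0 \<Longrightarrow> W s \<omega> = 0"
begin

lemma distributed_increment:
  "0 \<le> s \<Longrightarrow> s < t \<Longrightarrow>
    distributed M lborel (\<lambda>\<omega>. W t \<omega> - W s \<omega>) (normal_density 0 (sqrt (t - s)))"
  using brownian by (simp add: standard_brownian_motion_def)

lemma distributed_W: "0 < t \<Longrightarrow> distributed M lborel (W t) (normal_density 0 (sqrt t))"
  using distributed_increment[of 0 t] by (simp add: W_nonpos)

lemma past_indep_increment:
  assumes "0 \<le> m" "m < t"
  shows "indep_set (sigma_sets (space M) (process_events M {0..m} W))
    {(\<lambda>\<omega>. W t \<omega> - W m \<omega>) -` F \<inter> space M |F. F \<in> sets borel}"
proof (rule indep_set_process_events_finite[OF _ Int_stable_vimage])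
  fix J :: "real set" assume J: "finite J" "J \<subseteq> {0..m}"
  obtain u n where u: "u 0 = 0" "u n = m" "u (Suc n) = t" "incseq u" "J \<subseteq> u ` {..n}"
    using sorted_enumeration[OF J assms] .
  let ?X = "\<lambda>i \<omega>. W (u (Suc i)) \<omega> - W (u i) \<omega>"
  let ?K = "{(\<lambda>\<omega>. restrict (\<lambda>i. ?X i \<omega>) {..<n}) -` A \<inter> space M |A. A \<in> sets (Pi\<^sub>M {..<n} (\<lambda>_. borel))}"
  \<comment> \<open>The block \<open>{..<n}\<close> carries the past and the single index
    \<open>n\<close> carries \<open>W t - W m\<close>; disjoint blocks of an independent family are
    independent.\<close>
  have "indep_vars (\<lambda>_::nat. borel) ?X {..<Suc n}"
    using brownian u by (simp add: standard_brownian_motion_def)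
  then have ind: "indep_var (Pi\<^sub>M {..<n} (\<lambda>_. borel)) (\<lambda>\<omega>. restrict (\<lambda>i. ?X i \<omega>) {..<n})
      (Pi\<^sub>M {n} (\<lambda>_. borel)) (\<lambda>\<omega>. restrict (\<lambda>i. ?X i \<omega>) {n})"
    by (rule indep_var_restrict) auto
  let ?L = "{(\<lambda>\<omega>. restrict (\<lambda>i. ?X i \<omega>) {n}) -` A \<inter> space M |A. A \<in> sets (Pi\<^sub>M {n} (\<lambda>_. borel))}"
  have ind: "indep_set (sigma_sets (space M) ?K) (sigma_sets (space M) ?L)"
    using ind unfolding indep_var_eq by simp
  have incr: "{?X n -` F \<inter> space M |F. F \<in> sets borel} \<subseteq> sigma_sets (space M) ?L"
  proof safe
    fix F :: "real set" assume [measurable]: "F \<in> sets borel"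
    have "{g \<in> space (Pi\<^sub>M {n} (\<lambda>_. borel)). g n \<in> F} \<in> sets (Pi\<^sub>M {n} (\<lambda>_. borel))"
      by measurable
    moreover have "?X n -` F \<inter> space M = (\<lambda>\<omega>. restrict (\<lambda>i. ?X i \<omega>) {n}) -`
        {g \<in> space (Pi\<^sub>M {n} (\<lambda>_. borel)). g n \<in> F} \<inter> space M"
      by (auto simp: space_PiM)
    ultimately show "?X n -` F \<inter> space M \<in> sigma_sets (space M) ?L" by blast
  qed
  have "sigma_sets (space M) (process_events M J W) \<subseteq> sigma_sets (space M) ?K"
  proof (rule process_events_subset_sigma)
    let ?N = "sigma (space M) ?K"
    have [measurable]: "?X i \<in> borel_measurable ?N" if "i < n" for i
    proof (rule measurableI)
      fix A :: "real set" assume [measurable]: "A \<in> sets borel"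
      have "(\<lambda>g. g i) -` A \<inter> space (Pi\<^sub>M {..<n} (\<lambda>_. borel)) \<in> sets (Pi\<^sub>M {..<n} (\<lambda>_. borel))"
        using that by (intro measurable_sets[OF measurable_component_singleton]) auto
      moreover have "?X i -` A \<inter> space M = (\<lambda>\<omega>. restrict (\<lambda>i. ?X i \<omega>) {..<n}) -`
          ((\<lambda>g. g i) -` A \<inter> space (Pi\<^sub>M {..<n} (\<lambda>_. borel))) \<inter> space M"
        using that by (auto simp: space_PiM)
      ultimately have "?X i -` A \<inter> space M \<in> ?K" by blast
      then show "?X i -` A \<inter> space ?N \<in> sets ?N"
        by (subst sets_measure_of) (auto simp: space_measure_of_conv)
    qed simp
    fix s assume "s \<in> J"
    then obtain k where k: "k \<le> n" "s = u k" using u(5) by auto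
    \<comment> \<open>Telescoping starts from \<open>u 0 = 0\<close>, where \<open>W\<close>
      vanishes for every \<open>\<omega>\<close>; the values at the times of \<open>J\<close> are
      thus sums of increments from the first block.\<close>
    have "W s \<omega> = (\<Sum>i<k. ?X i \<omega>)" for \<omega>
      by (subst sum_lessThan_telescope) (simp add: k u W_nonpos)
    then have "W s = (\<lambda>\<omega>. \<Sum>i<k. ?X i \<omega>)" by auto
    with k show "W s \<in> borel_measurable ?N" by simp
  qed auto
  then show "indep_set (sigma_sets (space M) (process_events M J W))
    {(\<lambda>\<omega>. W t \<omega> - W m \<omega>) -` F \<inter> space M |F. F \<in> sets borel}"
    using incr unfolding u by (rule indep_set_mono[OF ind])
qed

end

section \<open>The Brownian bridge\<close>

text \<open>It appears in two roles: as a process in \<open>s\<close> up to the current time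
  \<open>t\<close> it is the past, and as \<open>brownian_bridge W r t\<close>, pinned at a possible
  value \<open>r > t\<close> of \<open>\<nu>\<close>, it is the noise at \<open>t\<close>.\<close>

definition brownian_bridge :: "(real \<Rightarrow> 'a \<Rightarrow> real) \<Rightarrow> real \<Rightarrow> real \<Rightarrow> 'a \<Rightarrow> real" where
  "brownian_bridge W t s \<omega> = W s \<omega> - s / t * W t \<omega>"

context regular_brownian_motion
begin

lemma brownian_bridge_measurable [measurable]: "brownian_bridge W t s \<in> borel_measurable M"
  unfolding brownian_bridge_def[abs_def] by measurable

lemma process_events_bridge_subset:
  assumes "S \<subseteq> {0..t}" "0 \<le> t"
  shows "sigma_sets (space M) (process_events M S (brownian_bridge W t)) \<subseteq>
    sigma_sets (space M) (process_events M {0..t} W)"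
proof (rule process_events_subset_sigma[OF _ process_events_Pow])
  fix s assume "s \<in> S"
  have *: "W r \<in> borel_measurable (sigma (space M) (process_events M {0..t} W))" if "r \<in> {0..t}" for r
    by (rule measurable_process_events[OF that _ process_events_Pow]) simp
  have [measurable]: "W s \<in> borel_measurable (sigma (space M) (process_events M {0..t} W))"
    "W t \<in> borel_measurable (sigma (space M) (process_events M {0..t} W))"
    using assms \<open>s \<in> S\<close> by (auto intro!: *)
  show "brownian_bridge W t s \<in> borel_measurable (sigma (space M) (process_events M {0..t} W))"
    unfolding brownian_bridge_def[abs_def] by measurable
qed

text \<open>A past event that is independent of \<open>W m\<close> is independent of the pair formed
  by \<open>W m\<close> and the increment up to \<open>t\<close>. The regression applies with
  \<open>a = m\<close> and \<open>b = t - m\<close>, so \<open>c = m / t\<close> and the residual is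
  the value of the bridge at \<open>m\<close>.\<close>

lemma bridge_endpoint_law:
  assumes "0 < m" "m < t"
    and \<Gamma>: "\<Gamma> \<in> sigma_sets (space M) (process_events M {0..m} W)"
    and ind: "\<And>E. E \<in> sets borel \<Longrightarrow>
      prob (\<Gamma> \<inter> (W m -` E \<inter> space M)) = prob \<Gamma> * prob (W m -` E \<inter> space M)"
    and "C \<in> sets borel" "E \<in> sets borel"
  shows "emeasure M (\<Gamma> \<inter> {\<omega> \<in> space M. brownian_bridge W t m \<omega> \<in> C \<and> W t \<omega> \<in> E}) =
    emeasure M \<Gamma> * (\<integral>\<^sup>+u\<in>C. normal_density 0 (sqrt (m * (t - m) / t)) u \<partial>lborel)
      * (\<integral>\<^sup>+v\<in>E. normal_density 0 (sqrt t) v \<partial>lborel)"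
proof -
  note past = past_indep_increment[OF less_imp_le[OF assms(1)] assms(2)]
  interpret P: sigma_algebra "space M" "sigma_sets (space M) (process_events M {0..m} W)"
    by (intro sigma_algebra_sigma_sets process_events_Pow)
  have "\<Gamma> \<in> events"
    using indep_setD_ev1[OF past] \<Gamma> by blast
  moreover have "emeasure M (\<Gamma> \<inter> (W m -` E \<inter> (\<lambda>\<omega>. W t \<omega> - W m \<omega>) -` F \<inter> space M)) =
        emeasure M \<Gamma> * emeasure M (W m -` E \<inter> space M) *
        emeasure M ((\<lambda>\<omega>. W t \<omega> - W m \<omega>) -` F \<inter> space M)"
    if "E \<in> sets borel" "F \<in> sets borel" for E F
  proof -
    have "W m -` E \<inter> space M \<in> process_events M {0..m} W"
      using assms(1) that(1) by (intro process_eventsI) auto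
    then have *: "\<Gamma> \<inter> (W m -` E \<inter> space M) \<in> sigma_sets (space M) (process_events M {0..m} W)"
      by (intro P.Int[OF \<Gamma>] sigma_sets.Basic)
    have "prob (\<Gamma> \<inter> (W m -` E \<inter> space M) \<inter> ((\<lambda>\<omega>. W t \<omega> - W m \<omega>) -` F \<inter> space M)) =
      prob (\<Gamma> \<inter> (W m -` E \<inter> space M)) * prob ((\<lambda>\<omega>. W t \<omega> - W m \<omega>) -` F \<inter> space M)"
      using that(2) by (intro indep_setD[OF past] *) blast
    moreover have "\<Gamma> \<inter> (W m -` E \<inter> space M) \<inter> ((\<lambda>\<omega>. W t \<omega> - W m \<omega>) -` F \<inter> space M) =
        \<Gamma> \<inter> (W m -` E \<inter> (\<lambda>\<omega>. W t \<omega> - W m \<omega>) -` F \<inter> space M)" by auto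
    ultimately show ?thesis
      using ind[OF that(1)] by (simp add: emeasure_eq_measure ennreal_mult)
  qed
  ultimately have "emeasure M (\<Gamma> \<inter> {\<omega> \<in> space M.
      W m \<omega> - m / (m + (t - m)) * (W m \<omega> + (W t \<omega> - W m \<omega>)) \<in> C \<and> W m \<omega> + (W t \<omega> - W m \<omega>) \<in> E}) =
    emeasure M \<Gamma> * (\<integral>\<^sup>+u\<in>C. normal_density 0 (sqrt (m * (t - m) / (m + (t - m)))) u \<partial>lborel)
      * (\<integral>\<^sup>+v\<in>E. normal_density 0 (sqrt (m + (t - m))) v \<partial>lborel)"
    using assms(1,2) by (intro gaussian_regression_residual distributed_W distributed_increment assms(5,6)) auto
  then show ?thesis by (simp add: brownian_bridge_def)
qed

text \<open>
  The induction adds times from the left: \<open>W s / s\<close> is Markov backwards in time with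
  independent increments \<open>brownian_bridge W t m / m\<close>.
\<close>

lemma bridge_indep_endpoint_finite:
  assumes "finite S" "S \<subseteq> {0<..<t}"
  shows "indep_set (sigma_sets (space M) (process_events M S (brownian_bridge W t)))
    {W t -` E \<inter> space M |E. E \<in> sets borel}"
  using assms
\<comment> \<open>\<open>t\<close> is generalised because the induction hypothesis is applied to the
  bridge that ends at the largest time \<open>m\<close> of the set.\<close>
proof (induction S arbitrary: t rule: finite_linorder_max_induct)
  case empty
  show ?case
    by (rule indep_setI) (auto simp: process_events_def sigma_sets_empty_eq prob_space)
next
  case (insert m S t)
  have mt: "0 < m" "m < t" using insert.prems by auto
  have S: "S \<subseteq> {0<..<m}" using insert.hyps insert.prems by auto
  let ?G = "sigma_sets (space M) (process_events M S (brownian_bridge W m))"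
  let ?K = "{\<Gamma> \<inter> (brownian_bridge W t m -` C \<inter> space M) |\<Gamma> C. \<Gamma> \<in> ?G \<and> C \<in> sets borel}"
  let ?E = "{W t -` E \<inter> space M |E. E \<in> sets borel}"
  interpret G: sigma_algebra "space M" ?G
    by (intro sigma_algebra_sigma_sets process_events_Pow)
  note IH = insert.IH[OF S]
  have Gpast: "?G \<subseteq> sigma_sets (space M) (process_events M {0..m} W)"
    using S mt by (intro process_events_bridge_subset) auto
  have Gev: "?G \<subseteq> events" by (rule indep_setD_ev1[OF IH])
  have law: "emeasure M (\<Gamma> \<inter> {\<omega> \<in> space M. brownian_bridge W t m \<omega> \<in> C \<and> W t \<omega> \<in> E}) =
    emeasure M \<Gamma> * (\<integral>\<^sup>+u\<in>C. normal_density 0 (sqrt (m * (t - m) / t)) u \<partial>lborel)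
      * (\<integral>\<^sup>+v\<in>E. normal_density 0 (sqrt t) v \<partial>lborel)"
    if "\<Gamma> \<in> ?G" "C \<in> sets borel" "E \<in> sets borel" for \<Gamma> C E
  proof (rule bridge_endpoint_law[OF mt _ _ that(2,3)])
    show "\<Gamma> \<in> sigma_sets (space M) (process_events M {0..m} W)" using Gpast that by blast
    show "prob (\<Gamma> \<inter> (W m -` E \<inter> space M)) = prob \<Gamma> * prob (W m -` E \<inter> space M)"
      if "E \<in> sets borel" for E
      using \<open>\<Gamma> \<in> ?G\<close> that by (intro indep_setD[OF IH]) auto
  qed
  have n1: "(\<integral>\<^sup>+v. normal_density 0 (sqrt t) v \<partial>lborel) = 1"
    using prob_space.emeasure_space_1[OF prob_space_normal_density[of "sqrt t" 0]] mt
    by (simp add: emeasure_density)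
  have "indep_set ?K ?E"
  proof (rule indep_setI)
    show "?K \<subseteq> events"
      using Gev by (auto intro!: sets.Int measurable_sets[OF brownian_bridge_measurable])
    show "?E \<subseteq> events" by (auto intro!: measurable_sets[OF W_measurable])
    fix a b assume "a \<in> ?K" "b \<in> ?E"
    then obtain \<Gamma> C E where ab: "\<Gamma> \<in> ?G" "C \<in> sets borel" "E \<in> sets borel"
      "a = \<Gamma> \<inter> (brownian_bridge W t m -` C \<inter> space M)" "b = W t -` E \<inter> space M" by auto
    \<comment> \<open>The masses of \<open>a\<close> and \<open>b\<close> come from the same law,
      with \<open>UNIV\<close> for the endpoint or, for \<open>b\<close>, with the sure event and
      \<open>UNIV\<close> for the bridge.\<close>
    have eq: "a \<inter> b = \<Gamma> \<inter> {\<omega> \<in> space M. brownian_bridge W t m \<omega> \<in> C \<and> W t \<omega> \<in> E}"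
      "a = \<Gamma> \<inter> {\<omega> \<in> space M. brownian_bridge W t m \<omega> \<in> C \<and> W t \<omega> \<in> UNIV}"
      "b = space M \<inter> {\<omega> \<in> space M. brownian_bridge W t m \<omega> \<in> UNIV \<and> W t \<omega> \<in> E}"
      using ab by auto
    have n2: "(\<integral>\<^sup>+u. normal_density 0 (sqrt (m * (t - m) / t)) u \<partial>lborel) = 1"
      using prob_space.emeasure_space_1[OF prob_space_normal_density[of "sqrt (m * (t - m) / t)" 0]] mt
      by (simp add: emeasure_density)
    have "emeasure M a = emeasure M \<Gamma> * (\<integral>\<^sup>+u\<in>C. normal_density 0 (sqrt (m * (t - m) / t)) u \<partial>lborel)"
      unfolding eq(2) law[OF ab(1,2) space_in_borel] by (simp add: n1)
    moreover have "emeasure M b = (\<integral>\<^sup>+v\<in>E. normal_density 0 (sqrt t) v \<partial>lborel)"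
      unfolding eq(3) law[OF G.top space_in_borel ab(3)] by (simp add: n2 emeasure_space_1)
    ultimately have "emeasure M (a \<inter> b) = emeasure M a * emeasure M b"
      unfolding eq(1) law[OF ab(1,2,3)] by simp
    then show "prob (a \<inter> b) = prob a * prob b"
      by (simp add: emeasure_eq_measure ennreal_mult[symmetric])
  qed
  moreover have "Int_stable ?K"
  proof (rule Int_stableI)
    fix a b assume "a \<in> ?K" "b \<in> ?K"
    then obtain \<Gamma> C \<Gamma>' C' where "\<Gamma> \<in> ?G" "\<Gamma>' \<in> ?G" "C \<in> sets borel" "C' \<in> sets borel"
      "a = \<Gamma> \<inter> (brownian_bridge W t m -` C \<inter> space M)" "b = \<Gamma>' \<inter> (brownian_bridge W t m -` C' \<inter> space M)"
      by auto
    then show "a \<inter> b \<in> ?K"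
      by (intro CollectI exI[of _ "\<Gamma> \<inter> \<Gamma>'"] exI[of _ "C \<inter> C'"]) (auto intro: G.Int)
  qed
  ultimately have ind: "indep_set (sigma_sets (space M) ?K) (sigma_sets (space M) ?E)"
    by (intro indep_set_sigma_sets Int_stable_vimage)
  have KPow: "?K \<subseteq> Pow (space M)" by auto
  have "sigma_sets (space M) (process_events M (insert m S) (brownian_bridge W t)) \<subseteq>
      sigma_sets (space M) ?K"
  proof (rule process_events_subset_sigma[OF _ KPow])
    let ?N = "sigma (space M) ?K"
    have N: "space ?N = space M" "sets ?N = sigma_sets (space M) ?K"
      using KPow by (simp_all add: space_measure_of_conv)
    have [measurable]: "brownian_bridge W t m \<in> borel_measurable ?N"
    proof (rule measurableI)
      fix C :: "real set" assume "C \<in> sets borel"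
      then have "space M \<inter> (brownian_bridge W t m -` C \<inter> space M) \<in> ?K" using G.top by blast
      then show "brownian_bridge W t m -` C \<inter> space ?N \<in> sets ?N"
        unfolding N by (intro sigma_sets.Basic) (simp add: Int_absorb1)
    qed simp
    have GK: "?G \<subseteq> sigma_sets (space M) ?K"
    proof
      fix \<Gamma> assume \<Gamma>: "\<Gamma> \<in> ?G"
      then have "\<Gamma> \<inter> (brownian_bridge W t m -` UNIV \<inter> space M) \<in> ?K"
        by (blast intro: space_in_borel)
      moreover have "\<Gamma> \<inter> (brownian_bridge W t m -` UNIV \<inter> space M) = \<Gamma>"
        using \<Gamma> Gev sets.sets_into_space by auto
      ultimately have "\<Gamma> \<in> ?K" by (simp only:)
      then show "\<Gamma> \<in> sigma_sets (space M) ?K" by (rule sigma_sets.Basic)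
    qed
    fix s assume s: "s \<in> insert m S"
    show "brownian_bridge W t s \<in> borel_measurable ?N"
    proof (cases "s = m")
      case False
      with s have [measurable]: "brownian_bridge W m s \<in> borel_measurable ?N"
        by (intro measurable_process_events[OF _ GK KPow]) auto
      \<comment> \<open>Up to time \<open>m\<close>, the bridge to \<open>t\<close> is the bridge to
        \<open>m\<close> plus a linear path towards its own value at \<open>m\<close>; both
        ingredients are measurable with respect to \<open>?K\<close>.\<close>
      have "brownian_bridge W t s = (\<lambda>\<omega>. brownian_bridge W m s \<omega> + s / m * brownian_bridge W t m \<omega>)"
        using mt by (auto simp: brownian_bridge_def field_simps)
      then show ?thesis by simp
    qed simp
  qed
  then show ?case by (rule indep_set_mono[OF ind]) auto
qed

lemma bridge_indep_endpoint:
  assumes "0 < t"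
  shows "indep_set (sigma_sets (space M) (process_events M {0..t} (brownian_bridge W t)))
    {W t -` E \<inter> space M |E. E \<in> sets borel}"
proof -
  have "indep_set (sigma_sets (space M) (process_events M {0<..<t} (brownian_bridge W t)))
    {W t -` E \<inter> space M |E. E \<in> sets borel}"
    by (rule indep_set_process_events_finite[OF bridge_indep_endpoint_finite Int_stable_vimage])
  \<comment> \<open>At the times 0 and \<open>t\<close>, where the variances in the regression would
    degenerate, the bridge is identically 0 and adds no information.\<close>
  moreover have "sigma_sets (space M) (process_events M {0..t} (brownian_bridge W t)) \<subseteq>
      sigma_sets (space M) (process_events M {0<..<t} (brownian_bridge W t))"
  proof (rule process_events_subset_sigma[OF _ process_events_Pow])
    fix s assume "s \<in> {0..t}"
    then consider "s \<in> {0<..<t}" | "s = 0" | "s = t" by fastforce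
    then show "brownian_bridge W t s \<in>
        borel_measurable (sigma (space M) (process_events M {0<..<t} (brownian_bridge W t)))"
    proof cases
      case 1
      then show ?thesis by (rule measurable_process_events[OF _ _ process_events_Pow]) simp
    next
      case 2
      then have "brownian_bridge W t s = (\<lambda>_. 0)"
        by (auto simp: brownian_bridge_def W_nonpos)
      then show ?thesis by simp
    next
      case 3
      then have "brownian_bridge W t s = (\<lambda>_. 0)"
        using assms by (auto simp: brownian_bridge_def)
      then show ?thesis by simp
    qed
  qed
  ultimately show ?thesis by (rule indep_set_mono) simp
qed

text \<open>The past of the bridge to \<open>t\<close> is an admissible \<open>\<Gamma>\<close> in
  \<open>bridge_endpoint_law\<close> at the times \<open>t\<close> and \<open>r\<close>: it belongs
  to the past of \<open>W\<close> and, by \<open>bridge_indep_endpoint\<close>, is independent of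
  \<open>W t\<close>. The endpoint \<open>W r\<close> is integrated out.\<close>

lemma emeasure_bridge_inter:
  assumes "0 < t" "t < r"
    and \<Gamma>: "\<Gamma> \<in> sigma_sets (space M) (process_events M {0..t} (brownian_bridge W t))"
    and "C \<in> sets borel"
  shows "emeasure M (\<Gamma> \<inter> (brownian_bridge W r t -` C \<inter> space M)) =
    emeasure M \<Gamma> * (\<integral>\<^sup>+u\<in>C. normal_density 0 (sqrt (t * (r - t) / r)) u \<partial>lborel)"
proof -
  have "emeasure M (\<Gamma> \<inter> {\<omega> \<in> space M. brownian_bridge W r t \<omega> \<in> C \<and> W r \<omega> \<in> UNIV}) =
    emeasure M \<Gamma> * (\<integral>\<^sup>+u\<in>C. normal_density 0 (sqrt (t * (r - t) / r)) u \<partial>lborel)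
      * (\<integral>\<^sup>+v\<in>UNIV. normal_density 0 (sqrt r) v \<partial>lborel)"
  proof (rule bridge_endpoint_law[OF assms(1,2) _ _ assms(4)])
    show "\<Gamma> \<in> sigma_sets (space M) (process_events M {0..t} W)"
      using process_events_bridge_subset[of "{0..t}" t] \<Gamma> assms(1) by auto
    show "prob (\<Gamma> \<inter> (W t -` E \<inter> space M)) = prob \<Gamma> * prob (W t -` E \<inter> space M)"
      if "E \<in> sets borel" for E
      using that by (intro indep_setD[OF bridge_indep_endpoint[OF assms(1)] \<Gamma>]) blast
  qed simp
  moreover have "(\<integral>\<^sup>+v. normal_density 0 (sqrt r) v \<partial>lborel) = 1"
    using prob_space.emeasure_space_1[OF prob_space_normal_density[of "sqrt r" 0]] assms
    by (simp add: emeasure_density)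
  moreover have "{\<omega> \<in> space M. brownian_bridge W r t \<omega> \<in> C \<and> W r \<omega> \<in> UNIV} =
      brownian_bridge W r t -` C \<inter> space M" by auto
  ultimately show ?thesis by simp
qed

end

section \<open>Regular versions and joint measurability\<close>

text \<open>Agreement almost everywhere on \<open>P\<close> survives complements and countable
  unions. \<open>P\<close> is trivial when versions are compared and is \<open>t < \<nu>\<close>
  when traces are compared.\<close>

lemma sigma_sets_AE_transfer:
  assumes basic: "\<And>a. a \<in> A \<Longrightarrow> \<exists>b\<in>sigma_sets (space M) B. AE \<omega> in M. P \<omega> \<longrightarrow> (\<omega> \<in> a \<longleftrightarrow> \<omega> \<in> b)"
    and "a \<in> sigma_sets (space M) A"
  shows "\<exists>b\<in>sigma_sets (space M) B. AE \<omega> in M. P \<omega> \<longrightarrow> (\<omega> \<in> a \<longleftrightarrow> \<omega> \<in> b)"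
  using assms(2)
proof (induction rule: sigma_sets.induct)
  case (Basic a)
  then show ?case by (rule basic)
next
  case Empty
  then show ?case by (auto intro!: bexI[of _ "{}"] sigma_sets.Empty)
next
  case (Compl a)
  then obtain b where "b \<in> sigma_sets (space M) B" "AE \<omega> in M. P \<omega> \<longrightarrow> (\<omega> \<in> a \<longleftrightarrow> \<omega> \<in> b)" by auto
  then show ?case
    by (intro bexI[of _ "space M - b"] sigma_sets.Compl) auto
next
  case (Union a)
  then have "\<forall>i. \<exists>b\<in>sigma_sets (space M) B. AE \<omega> in M. P \<omega> \<longrightarrow> (\<omega> \<in> a i \<longleftrightarrow> \<omega> \<in> b)" by auto
  then obtain b where b: "\<And>i::nat. b i \<in> sigma_sets (space M) B"
    "\<And>i. AE \<omega> in M. P \<omega> \<longrightarrow> (\<omega> \<in> a i \<longleftrightarrow> \<omega> \<in> b i)" by metis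
  have "AE \<omega> in M. \<forall>i. P \<omega> \<longrightarrow> (\<omega> \<in> a i \<longleftrightarrow> \<omega> \<in> b i)"
    unfolding AE_all_countable using b(2) by blast
  then have "AE \<omega> in M. P \<omega> \<longrightarrow> (\<omega> \<in> (\<Union>i. a i) \<longleftrightarrow> \<omega> \<in> (\<Union>i. b i))" by auto
  with b(1) show ?case by (intro bexI[of _ "\<Union>i. b i"] sigma_sets.Union)
qed

section \<open>Passing to an almost surely equal version with regular paths\<close>

lemma process_indep_of_pair_cong_AE:
  assumes "prob_space M" "process_indep_of_pair M I X Y Z"
    and eq: "AE \<omega> in M. \<forall>s\<in>I. X' s \<omega> = X s \<omega>"
    and [measurable]: "\<And>s. s \<in> I \<Longrightarrow> X' s \<in> borel_measurable M"
  shows "process_indep_of_pair M I X' Y Z"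
proof -
  interpret prob_space M by fact
  let ?V = "sets (vimage_algebra (space M) (\<lambda>\<omega>. (Y \<omega>, Z \<omega>)) borel)"
  have ind: "indep_set (sigma_sets (space M) (process_events M I X)) ?V"
    using assms(2) by (simp add: process_indep_of_pair_def)
  have ev: "sigma_sets (space M) (process_events M I X') \<subseteq> events"
    by (intro sets.sigma_sets_subset process_events_subset_sets) measurable
  show ?thesis
    unfolding process_indep_of_pair_def
  proof (rule indep_setI)
    show "?V \<subseteq> events" by (rule indep_setD_ev2[OF ind])
    fix a v assume a: "a \<in> sigma_sets (space M) (process_events M I X')" and v: "v \<in> ?V"
    have "\<exists>b\<in>sigma_sets (space M) (process_events M I X).
        AE \<omega> in M. True \<longrightarrow> (\<omega> \<in> a \<longleftrightarrow> \<omega> \<in> b)"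
    proof (rule sigma_sets_AE_transfer[OF _ a])
      fix c assume "c \<in> process_events M I X'"
      then obtain s A where s: "s \<in> I" "A \<in> sets borel" "c = X' s -` A \<inter> space M"
        by (auto simp: process_events_def)
      then have "X s -` A \<inter> space M \<in> sigma_sets (space M) (process_events M I X)"
        by (intro sigma_sets.Basic process_eventsI)
      moreover have "AE \<omega> in M. True \<longrightarrow> (\<omega> \<in> c \<longleftrightarrow> \<omega> \<in> X s -` A \<inter> space M)"
        using eq by eventually_elim (use s in auto)
      ultimately show "\<exists>b\<in>sigma_sets (space M) (process_events M I X).
        AE \<omega> in M. True \<longrightarrow> (\<omega> \<in> c \<longleftrightarrow> \<omega> \<in> b)" by blast
    qed
    then obtain b where b: "b \<in> sigma_sets (space M) (process_events M I X)"
      and ab: "AE \<omega> in M. \<omega> \<in> a \<longleftrightarrow> \<omega> \<in> b" by auto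
    have m: "a \<in> events" "b \<in> events" "v \<in> events"
      using ev a b v indep_setD_ev1[OF ind] indep_setD_ev2[OF ind] by auto
    have "prob (a \<inter> v) = prob (b \<inter> v)"
      by (intro finite_measure_eq_AE) (use ab m in auto)
    also have "\<dots> = prob b * prob v" by (rule indep_setD[OF ind b v])
    also have "prob b = prob a"
      by (intro finite_measure_eq_AE) (use ab m in auto)
    finally show "prob (a \<inter> v) = prob a * prob v" .
  qed (rule ev)
qed

text \<open>Independence is an identity between the joint law and the product of the marginal laws,
  and laws do not see null sets.\<close>

lemma (in prob_space) indep_vars_cong_AE:
  assumes ind: "indep_vars N X I"
    and rv: "\<And>i. i \<in> I \<Longrightarrow> X' i \<in> measurable M (N i)"
    and eq: "AE \<omega> in M. \<forall>i\<in>I. X' i \<omega> = X i \<omega>"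
  shows "indep_vars N X' I"
proof (cases "I = {}")
  case True
  then show ?thesis by (simp add: indep_vars_def indep_sets_def)
next
  case False
  have X: "X i \<in> measurable M (N i)" if "i \<in> I" for i
    using ind that by (auto simp: indep_vars_def)
  have "distr M (Pi\<^sub>M I N) (\<lambda>\<omega>. \<lambda>i\<in>I. X' i \<omega>) = distr M (Pi\<^sub>M I N) (\<lambda>\<omega>. \<lambda>i\<in>I. X i \<omega>)"
  proof (rule distr_cong_AE[OF refl refl])
    show "AE \<omega> in M. (\<lambda>i\<in>I. X' i \<omega>) = (\<lambda>i\<in>I. X i \<omega>)"
      using eq by eventually_elim auto
  qed (auto intro!: measurable_restrict X rv)
  also have "\<dots> = Pi\<^sub>M I (\<lambda>i. distr M (N i) (X i))"
    using ind X by (subst (asm) indep_vars_iff_distr_eq_PiM'[OF False]) auto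
  also have "\<dots> = Pi\<^sub>M I (\<lambda>i. distr M (N i) (X' i))"
  proof (rule PiM_cong[OF refl])
    fix i assume "i \<in> I"
    then show "distr M (N i) (X i) = distr M (N i) (X' i)"
      using eq by (intro distr_cong_AE X rv) auto
  qed
  finally show ?thesis
    using rv by (subst indep_vars_iff_distr_eq_PiM'[OF False]) auto
qed

lemma standard_brownian_motion_cong_AE:
  assumes "prob_space M" and W: "standard_brownian_motion M W"
    and eq: "AE \<omega> in M. \<forall>s\<ge>0. W' s \<omega> = W s \<omega>"
    and W' [measurable]: "\<And>s. 0 \<le> s \<Longrightarrow> W' s \<in> borel_measurable M"
  shows "standard_brownian_motion M W'"
proof -
  interpret prob_space M by fact
  have Wm: "W s \<in> borel_measurable M" if "0 \<le> s" for s
    using W that by (simp add: standard_brownian_motion_def)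
  have "AE \<omega> in M. W 0 \<omega> = 0" "AE \<omega> in M. continuous_on {0..} (\<lambda>t. W t \<omega>)"
    using W by (simp_all add: standard_brownian_motion_def)
  with eq have "AE \<omega> in M. W' 0 \<omega> = 0 \<and> continuous_on {0..} (\<lambda>t. W' t \<omega>)"
    by eventually_elim (auto intro: continuous_on_eq)
  moreover have "distributed M lborel (\<lambda>\<omega>. W' t \<omega> - W' s \<omega>) (normal_density 0 (sqrt (t - s)))"
    if "0 \<le> s" "s < t" for s t
  proof -
    have "distr M lborel (\<lambda>\<omega>. W' t \<omega> - W' s \<omega>) = distr M lborel (\<lambda>\<omega>. W t \<omega> - W s \<omega>)"
    proof (rule distr_cong_AE[OF refl refl])
      show "AE \<omega> in M. W' t \<omega> - W' s \<omega> = W t \<omega> - W s \<omega>"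
        using eq by eventually_elim (use that in auto)
    qed (use that Wm W' in auto)
    moreover have "distributed M lborel (\<lambda>\<omega>. W t \<omega> - W s \<omega>) (normal_density 0 (sqrt (t - s)))"
      using W that by (simp add: standard_brownian_motion_def)
    ultimately show ?thesis
      using that W' by (simp add: distributed_def)
  qed
  moreover have "indep_vars (\<lambda>_::nat. borel) (\<lambda>i \<omega>. W' (u (Suc i)) \<omega> - W' (u i) \<omega>) {..<n}"
    if u: "0 \<le> u 0" "incseq u" for u n
  proof (rule indep_vars_cong_AE)
    have u0: "0 \<le> u i" for i using u incseqD[OF u(2), of 0 i] by simp
    show "indep_vars (\<lambda>_::nat. borel) (\<lambda>i \<omega>. W (u (Suc i)) \<omega> - W (u i) \<omega>) {..<n}"
      using W u by (simp add: standard_brownian_motion_def)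
    show "AE \<omega> in M. \<forall>i\<in>{..<n}. W' (u (Suc i)) \<omega> - W' (u i) \<omega> = W (u (Suc i)) \<omega> - W (u i) \<omega>"
      using eq by eventually_elim (simp add: u0)
    show "(\<lambda>\<omega>. W' (u (Suc i)) \<omega> - W' (u i) \<omega>) \<in> borel_measurable M" for i
      using W' u0 by simp
  qed
  ultimately show ?thesis
    unfolding standard_brownian_motion_def using W' by auto
qed

lemma regular_brownian_motion_version:
  assumes "prob_space M" and W: "standard_brownian_motion M W"
  obtains W' where "regular_brownian_motion M W'" "AE \<omega> in M. \<forall>s\<ge>0. W' s \<omega> = W s \<omega>"
proof -
  interpret prob_space M by fact
  have [measurable]: "W (max s 0) \<in> borel_measurable M" for s
    using W by (simp add: standard_brownian_motion_def)
  have "AE \<omega> in M. W 0 \<omega> = 0" "AE \<omega> in M. continuous_on {0..} (\<lambda>t. W t \<omega>)"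
    using W by (simp_all add: standard_brownian_motion_def)
  then have "AE \<omega> in M. W 0 \<omega> = 0 \<and> continuous_on {0..} (\<lambda>t. W t \<omega>)"
    by eventually_elim auto
  then obtain N where N: "N \<in> null_sets M"
    "\<And>\<omega>. \<omega> \<in> space M - N \<Longrightarrow> W 0 \<omega> = 0 \<and> continuous_on {0..} (\<lambda>t. W t \<omega>)"
    by (elim AE_E3) blast
  then have [measurable]: "N \<in> sets M" by auto
  \<comment> \<open>Exceptional paths are set to 0, and every path is frozen at negative times, so
    that continuity holds on the whole line.\<close>
  define W' where "W' s \<omega> = (if \<omega> \<in> space M - N then W (max s 0) \<omega> else 0)" for s \<omega>
  have W'm: "W' s \<in> borel_measurable M" for s
    unfolding W'_def[abs_def] by measurable
  have eq: "AE \<omega> in M. \<forall>s\<ge>0. W' s \<omega> = W s \<omega>"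
    using AE_not_in[OF N(1)] AE_space by eventually_elim (simp add: W'_def)
  have "standard_brownian_motion M W'"
    by (rule standard_brownian_motion_cong_AE[OF assms eq W'm])
  moreover have "continuous_on UNIV (\<lambda>s. W' s \<omega>)" for \<omega>
  proof (cases "\<omega> \<in> space M - N")
    case True
    have "continuous_on UNIV (\<lambda>s. W (max s 0) \<omega>)"
      by (rule continuous_on_compose2[of "{0..}" "\<lambda>t. W t \<omega>"])
         (use N(2)[OF True] in \<open>auto intro!: continuous_intros\<close>)
    with True show ?thesis by (simp add: W'_def)
  next
    case False
    then show ?thesis by (simp only: W'_def if_False continuous_on_const)
  qed
  moreover have "W' s \<omega> = 0" if "s \<le> 0" for s \<omega>
    using that N(2)[of \<omega>] by (auto simp: W'_def max_def)
  ultimately have "regular_brownian_motion M W'"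
    by unfold_locales (auto intro: W'm)
  then show ?thesis using eq by (rule that)
qed

section \<open>Joint measurability and the product law of the path and the pair\<close>

context regular_brownian_motion
begin

text \<open>Independence from the pair is known for path events only, so the first factor of the
  product law carries this sigma-algebra and not that of \<open>M\<close>.\<close>

definition path_algebra :: "'a measure" where
  "path_algebra = sigma (space M) (process_events M {0..} W)"

lemma space_path_algebra [simp]: "space path_algebra = space M"
  by (simp add: path_algebra_def space_measure_of_conv)

lemma sets_path_algebra: "sets path_algebra = sigma_sets (space M) (process_events M {0..} W)"
  by (simp add: path_algebra_def process_events_Pow)

lemma ident_measurable_path_algebra [measurable]: "(\<lambda>\<omega>. \<omega>) \<in> measurable M path_algebra"
proof (rule measurableI)
  fix A assume "A \<in> sets path_algebra"
  then have "A \<in> events"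
    unfolding sets_path_algebra
    using sets.sigma_sets_subset[OF process_events_subset_sets[of "{0..}" W M]] W_measurable by blast
  then show "(\<lambda>\<omega>. \<omega>) -` A \<inter> space M \<in> events" by simp
qed simp

lemma W_measurable_path_algebra [measurable]: "W s \<in> borel_measurable path_algebra"
proof (cases "0 \<le> s")
  case True
  then show ?thesis
    unfolding path_algebra_def by (intro measurable_process_events[where I="{0..}"] process_events_Pow) auto
next
  case False
  then have "W s = (\<lambda>_. 0)" by (auto simp: W_nonpos)
  then show ?thesis by simp
qed

text \<open>By continuity \<open>W s\<close> is the limit of its values at the grid points
  \<open>floor ((n + 1) * s) / (n + 1)\<close>; for fixed \<open>n\<close> these are countably many
  times, so measurability at fixed times is enough.\<close>

lemma W_jointly_measurable:
  "(\<lambda>p. W (snd p) (fst p)) \<in> borel_measurable (path_algebra \<Otimes>\<^sub>M borel)"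
proof (rule borel_measurable_LIMSEQ_real)
  fix p :: "'a \<times> real"
  have "(\<lambda>n. real_of_int \<lfloor>real (Suc n) * snd p\<rfloor> / real (Suc n)) \<longlonglongrightarrow> snd p"
  proof (rule tendsto_sandwich)
    show "\<forall>\<^sub>F n in sequentially. snd p - 1 / real (Suc n) \<le> real_of_int \<lfloor>real (Suc n) * snd p\<rfloor> / real (Suc n)"
    proof (intro always_eventually allI)
      fix n
      have "real (Suc n) * snd p - 1 \<le> real_of_int \<lfloor>real (Suc n) * snd p\<rfloor>" by linarith
      then have "(real (Suc n) * snd p - 1) / real (Suc n) \<le> real_of_int \<lfloor>real (Suc n) * snd p\<rfloor> / real (Suc n)"
        by (rule divide_right_mono) simp
      then show "snd p - 1 / real (Suc n) \<le> real_of_int \<lfloor>real (Suc n) * snd p\<rfloor> / real (Suc n)"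
        by (simp add: diff_divide_distrib)
    qed
    show "\<forall>\<^sub>F n in sequentially. real_of_int \<lfloor>real (Suc n) * snd p\<rfloor> / real (Suc n) \<le> snd p"
    proof (intro always_eventually allI)
      fix n
      have "real_of_int \<lfloor>real (Suc n) * snd p\<rfloor> \<le> real (Suc n) * snd p" by linarith
      then show "real_of_int \<lfloor>real (Suc n) * snd p\<rfloor> / real (Suc n) \<le> snd p"
        by (simp add: field_simps)
    qed
    show "(\<lambda>n. snd p - 1 / real (Suc n)) \<longlonglongrightarrow> snd p"
      using tendsto_diff[OF tendsto_const LIMSEQ_inverse_real_of_nat, of "snd p"]
      by (simp add: inverse_eq_divide)
  qed simp
  moreover have "isCont (\<lambda>s. W s (fst p)) (snd p)"
    using W_continuous by (simp add: continuous_on_eq_continuous_at)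
  ultimately show "(\<lambda>n. W (real_of_int \<lfloor>real (Suc n) * snd p\<rfloor> / real (Suc n)) (fst p)) \<longlonglongrightarrow> W (snd p) (fst p)"
    by (rule isCont_tendsto_compose[rotated])
next
  fix n
  show "(\<lambda>p. W (real_of_int \<lfloor>real (Suc n) * snd p\<rfloor> / real (Suc n)) (fst p))
      \<in> borel_measurable (path_algebra \<Otimes>\<^sub>M borel)"
    by (rule measurable_compose_countable[where g="\<lambda>p. \<lfloor>real (Suc n) * snd p\<rfloor>"
      and f="\<lambda>i p. W (real_of_int i / real (Suc n)) (fst p)"]) measurable
qed

text \<open>On the right the path and the pair are drawn separately, so \<open>Y\<close> and
  \<open>Z\<close> are constants under the inner integral. This plays the part of conditioning on
  \<open>(\<tau>, Z)\<close>.\<close>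

lemma nn_integral_indep_pair:
  fixes Y Z :: "'a \<Rightarrow> real"
  assumes ind: "process_indep_of_pair M {0..} W Y Z"
    and [measurable]: "Y \<in> borel_measurable M" "Z \<in> borel_measurable M"
    and \<Phi> [measurable]: "\<Phi> \<in> borel_measurable (path_algebra \<Otimes>\<^sub>M borel)"
  shows "(\<integral>\<^sup>+\<omega>. \<Phi> (\<omega>, Y \<omega>, Z \<omega>) \<partial>M) = (\<integral>\<^sup>+\<omega>'. \<integral>\<^sup>+\<omega>. \<Phi> (\<omega>, Y \<omega>', Z \<omega>') \<partial>M \<partial>M)"
proof -
  let ?YZ = "\<lambda>\<omega>. (Y \<omega>, Z \<omega>)"
  have [measurable]: "?YZ \<in> borel_measurable M" by measurable
  let ?M1 = "distr M path_algebra (\<lambda>\<omega>. \<omega>)" and ?M2 = "distr M borel ?YZ"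
  interpret M1: prob_space ?M1 by (rule prob_space_distr) measurable
  interpret M2: prob_space ?M2 by (rule prob_space_distr) measurable
  interpret P: pair_sigma_finite ?M1 ?M2 ..
  have eq: "?M1 \<Otimes>\<^sub>M ?M2 = distr M (path_algebra \<Otimes>\<^sub>M borel) (\<lambda>\<omega>. (\<omega>, ?YZ \<omega>))"
  proof (rule pair_measure_eqI)
    show "sets (?M1 \<Otimes>\<^sub>M ?M2) = sets (distr M (path_algebra \<Otimes>\<^sub>M borel) (\<lambda>\<omega>. (\<omega>, ?YZ \<omega>)))"
      by (simp cong: sets_pair_measure_cong)
    fix A B assume "A \<in> sets ?M1" "B \<in> sets ?M2"
    then have [measurable]: "A \<in> sets path_algebra" "B \<in> sets borel" by auto
    have A: "(\<lambda>\<omega>. \<omega>) -` A \<inter> space M = A" "A \<inter> space M = A"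
      using sets.sets_into_space[of A path_algebra] by auto
    have "?YZ -` B \<inter> space M \<in> sets (vimage_algebra (space M) ?YZ borel)"
      by (rule in_vimage_algebra) measurable
    then have "prob (A \<inter> (?YZ -` B \<inter> space M)) = prob A * prob (?YZ -` B \<inter> space M)"
      using ind \<open>A \<in> sets path_algebra\<close>
      unfolding process_indep_of_pair_def sets_path_algebra by (intro indep_setD) auto
    moreover have "(\<lambda>\<omega>. (\<omega>, ?YZ \<omega>)) -` (A \<times> B) \<inter> space M = A \<inter> (?YZ -` B \<inter> space M)"
      using A by auto
    ultimately show "emeasure ?M1 A * emeasure ?M2 B =
        emeasure (distr M (path_algebra \<Otimes>\<^sub>M borel) (\<lambda>\<omega>. (\<omega>, ?YZ \<omega>))) (A \<times> B)"
      by (simp add: emeasure_distr A emeasure_eq_measure ennreal_mult)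
  qed unfold_locales
  have [measurable]: "\<Phi> \<in> borel_measurable (?M1 \<Otimes>\<^sub>M ?M2)"
    by (simp cong: measurable_cong_sets sets_pair_measure_cong)
  have "(\<integral>\<^sup>+\<omega>. \<Phi> (\<omega>, Y \<omega>, Z \<omega>) \<partial>M) = integral\<^sup>N (?M1 \<Otimes>\<^sub>M ?M2) \<Phi>"
    unfolding eq by (simp add: nn_integral_distr)
  also have "\<dots> = (\<integral>\<^sup>+y. \<integral>\<^sup>+\<omega>. \<Phi> (\<omega>, y) \<partial>?M1 \<partial>?M2)"
    by (rule P.nn_integral_snd[symmetric]) measurable
  also have "\<dots> = (\<integral>\<^sup>+\<omega>'. \<integral>\<^sup>+\<omega>. \<Phi> (\<omega>, Y \<omega>', Z \<omega>') \<partial>?M1 \<partial>M)"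
    by (subst nn_integral_distr) measurable
  also have "\<dots> = (\<integral>\<^sup>+\<omega>'. \<integral>\<^sup>+\<omega>. \<Phi> (\<omega>, Y \<omega>', Z \<omega>') \<partial>M \<partial>M)"
    by (intro nn_integral_cong nn_integral_distr) measurable
  finally show ?thesis .
qed

end

section \<open>The law of the information process before default\<close>

lemma bridge_density_nonneg [simp]: "0 \<le> bridge_density \<sigma> t r z x"
  by (simp add: bridge_density_def)

lemma bridge_density_measurable [measurable]:
  assumes [measurable]: "r \<in> borel_measurable N" "z \<in> borel_measurable N" "x \<in> borel_measurable N"
  shows "(\<lambda>\<omega>. bridge_density \<sigma> t (r \<omega>) (z \<omega>) (x \<omega>)) \<in> borel_measurable N"
  unfolding bridge_density_def normal_density_def by measurable

text \<open>The time \<open>t\<close> is fixed once and for all, and \<open>W\<close> is the regular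
  version; the process of the theorem, built from the original paths, meets this context only
  through almost sure equality on \<open>[0, t]\<close>.\<close>

locale market_information = regular_brownian_motion M W
  for M :: "'a measure" and W +
  fixes \<tau> Z :: "'a \<Rightarrow> real" and T \<sigma> t :: real and l :: nat and z p :: "nat \<Rightarrow> real"
    and f :: "real \<Rightarrow> real \<Rightarrow> real"
  assumes \<sigma>_pos: "0 < \<sigma>" and t_pos: "0 < t" and t_less: "t < T"
    and \<tau>_measurable [measurable]: "\<tau> \<in> borel_measurable M"
    and \<tau>_pos: "\<And>\<omega>. \<omega> \<in> space M \<Longrightarrow> 0 < \<tau> \<omega>"
    and Z_measurable [measurable]: "Z \<in> borel_measurable M"
    and indep: "process_indep_of_pair M {0..} W \<tau> Z"
    and z_inj: "inj_on z {1..l}"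
    and Z_range: "\<And>\<omega>. \<omega> \<in> space M \<Longrightarrow> Z \<omega> \<in> z ` {1..l}"
    and p_eq: "\<And>i. i \<in> {1..l} \<Longrightarrow> prob {\<omega> \<in> space M. Z \<omega> = z i} = p i"
    and p_pos: "\<And>i. i \<in> {1..l} \<Longrightarrow> 0 < p i"
    and f_cont: "\<And>i. i \<in> {1..l} \<Longrightarrow> continuous_on {0..} (\<lambda>r. f r (z i))"
    and f_nonneg: "\<And>i r. i \<in> {1..l} \<Longrightarrow> 0 \<le> r \<Longrightarrow> 0 \<le> f r (z i)"
    and f_density: "\<And>i. i \<in> {1..l} \<Longrightarrow>
       distributed (uniform_measure M {\<omega> \<in> space M. Z \<omega> = z i}) lborel \<tau>
         (\<lambda>r. ennreal (indicator {0..} r * f r (z i)))"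
begin

definition \<nu> :: "'a \<Rightarrow> real" where "\<nu> \<omega> = min (\<tau> \<omega>) T"

definition \<zeta> :: "real \<Rightarrow> 'a \<Rightarrow> real" where "\<zeta> = information_process \<sigma> W \<nu> Z"

text \<open>Density of \<open>\<tau>\<close> given \<open>Z = z i\<close>, cut off at 0: continuity
  and sign of \<open>f\<close> are known only for \<open>r \<ge> 0\<close>, while the integrals run
  over the whole line.\<close>

definition g :: "nat \<Rightarrow> real \<Rightarrow> real" where "g i r = indicator {0..} r * f r (z i)"

lemma \<nu>_measurable [measurable]: "\<nu> \<in> borel_measurable M"
  unfolding \<nu>_def[abs_def] by measurable

lemma g_measurable [measurable]: "i \<in> {1..l} \<Longrightarrow> g i \<in> borel_measurable borel"
  using borel_measurable_continuous_on_indicator[OF _ f_cont[of i]]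
  unfolding g_def[abs_def] by simp

lemma g_nonneg: "i \<in> {1..l} \<Longrightarrow> 0 \<le> g i r"
  using f_nonneg by (simp add: g_def indicator_def)

lemma g_eq: "0 \<le> r \<Longrightarrow> g i r = f r (z i)"
  by (simp add: g_def)

lemma \<zeta>_before:
  assumes "0 \<le> s" "s < \<nu> \<omega>"
  shows "\<zeta> s \<omega> = brownian_bridge W (\<nu> \<omega>) s \<omega> + s / \<nu> \<omega> * \<sigma> * Z \<omega>"
  using assms by (simp add: \<zeta>_def information_process_def brownian_bridge_def)

text \<open>Before default \<open>\<zeta> s\<close> is \<open>W s\<close> plus \<open>s\<close>
  times a slope that does not depend on \<open>s\<close>; the unknown \<open>\<nu>\<close>,
  \<open>W \<nu>\<close> and \<open>Z\<close> enter only through this slope, and the value at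
  \<open>t\<close> eliminates it.\<close>

lemma \<zeta>_before_decomp:
  assumes "0 \<le> s" "s \<le> t" "t < \<nu> \<omega>"
  shows "\<zeta> s \<omega> = s / t * \<zeta> t \<omega> + brownian_bridge W t s \<omega>"
  using assms t_pos by (simp add: \<zeta>_before) (simp add: brownian_bridge_def field_simps)

lemma \<zeta>_after:
  assumes "\<omega> \<in> space M" "\<nu> \<omega> \<le> s"
  shows "\<zeta> s \<omega> = \<sigma> * Z \<omega>"
proof -
  have "\<nu> \<omega> > 0" using assms \<tau>_pos t_pos t_less by (simp add: \<nu>_def)
  with assms show ?thesis by (simp add: \<zeta>_def information_process_def)
qed

lemma W_random_time_measurable [measurable]:
  assumes [measurable]: "r \<in> borel_measurable M"
  shows "(\<lambda>\<omega>. W (r \<omega>) \<omega>) \<in> borel_measurable M"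
  using measurable_compose[OF measurable_Pair[OF ident_measurable_path_algebra assms] W_jointly_measurable]
  by simp

lemma \<zeta>_measurable [measurable]: "\<zeta> s \<in> borel_measurable M"
  unfolding \<zeta>_def information_process_def[abs_def] by measurable

lemma nn_integral_bridge:
  assumes r: "t < r"
    and B: "B \<in> sigma_sets (space M) (process_events M {0..t} (brownian_bridge W t))"
    and [measurable]: "h \<in> borel_measurable borel"
  shows "(\<integral>\<^sup>+\<omega>\<in>B. h (brownian_bridge W r t \<omega> + t / r * \<sigma> * y) \<partial>M) =
    emeasure M B * (\<integral>\<^sup>+x. h x * bridge_density \<sigma> t r y x \<partial>lborel)"
proof -
  let ?n = "normal_density 0 (sqrt (t * (r - t) / r))"
  have B' [measurable]: "B \<in> events"
    using B indep_setD_ev1[OF bridge_indep_endpoint[OF t_pos]] by blast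
  have "distr (density M (indicator B)) borel (brownian_bridge W r t) =
      density lborel (\<lambda>u. emeasure M B * ?n u)"
  proof (rule measure_eqI)
    fix C assume "C \<in> sets (distr (density M (indicator B)) borel (brownian_bridge W r t))"
    then have [measurable]: "C \<in> sets borel" by simp
    have "emeasure (distr (density M (indicator B)) borel (brownian_bridge W r t)) C =
        emeasure M (B \<inter> (brownian_bridge W r t -` C \<inter> space M))"
      by (simp add: emeasure_distr emeasure_restricted)
    also have "\<dots> = emeasure (density lborel (\<lambda>u. emeasure M B * ?n u)) C"
      using t_pos r B by (simp add: emeasure_bridge_inter emeasure_density nn_integral_cmult mult.assoc)
    finally show "emeasure (distr (density M (indicator B)) borel (brownian_bridge W r t)) C =
        emeasure (density lborel (\<lambda>u. emeasure M B * ?n u)) C" .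
  qed simp
  then have "(\<integral>\<^sup>+u. h (u + t / r * \<sigma> * y) \<partial>distr (density M (indicator B)) borel (brownian_bridge W r t)) =
      (\<integral>\<^sup>+u. h (u + t / r * \<sigma> * y) \<partial>density lborel (\<lambda>u. emeasure M B * ?n u))"
    by simp
  then have "(\<integral>\<^sup>+\<omega>\<in>B. h (brownian_bridge W r t \<omega> + t / r * \<sigma> * y) \<partial>M) =
      emeasure M B * (\<integral>\<^sup>+u. h (u + t / r * \<sigma> * y) * ?n u \<partial>lborel)"
    by (simp add: nn_integral_distr nn_integral_density nn_integral_cmult[symmetric] ac_simps)
  also have "(\<integral>\<^sup>+u. h (u + t / r * \<sigma> * y) * ?n u \<partial>lborel) =
      (\<integral>\<^sup>+x. h x * bridge_density \<sigma> t r y x \<partial>lborel)"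
    by (subst (2) nn_integral_real_affine[where c=1 and t="t / r * \<sigma> * y"])
       (simp_all add: bridge_density_def normal_density_def add.commute)
  finally show ?thesis .
qed

text \<open>Freezing the pair makes the pinning time a constant \<open>r > t\<close>. The past
  bridge event is then independent of the noise at \<open>t\<close>, with a probability that does
  not involve \<open>r\<close>, so \<open>emeasure M B\<close> leaves the integral.\<close>

lemma nn_integral_before_conditional:
  assumes B: "B \<in> sigma_sets (space M) (process_events M {0..t} (brownian_bridge W t))"
    and \<psi> [measurable]: "\<psi> \<in> borel_measurable borel"
  shows "(\<integral>\<^sup>+\<omega>. indicator B \<omega> * (indicator {t<..} (\<nu> \<omega>) * \<psi> (Z \<omega>, \<zeta> t \<omega>)) \<partial>M) =
    emeasure M B * (\<integral>\<^sup>+\<omega>. indicator {t<..} (\<nu> \<omega>) *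
      (\<integral>\<^sup>+x. \<psi> (Z \<omega>, x) * bridge_density \<sigma> t (\<nu> \<omega>) (Z \<omega>) x \<partial>lborel) \<partial>M)"
proof -
  let ?b = "\<lambda>r y \<omega>. brownian_bridge W r t \<omega> + t / r * \<sigma> * y"
  have [measurable]: "B \<in> sets path_algebra"
  proof -
    have "sigma_sets (space M) (process_events M {0..t} (brownian_bridge W t)) \<subseteq> sets path_algebra"
      unfolding sets_path_algebra
      using process_events_bridge_subset[of "{0..t}" t] t_pos
        sigma_sets_mono'[OF process_events_mono[of "{0..t}" "{0..}" M W], of "space M"] by force
    then show ?thesis using B by blast
  qed
  \<comment> \<open>\<open>min (fst (snd q)) T\<close> is \<open>\<nu>\<close> as a function of the
    pair, and its indicator confines the integrand to \<open>t < \<nu>\<close>, where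
    \<open>\<zeta>_before\<close> applies.\<close>
  let ?\<Phi> = "\<lambda>q. indicator B (fst q) * (indicator {t<..} (min (fst (snd q)) T) *
      \<psi> (snd (snd q), ?b (min (fst (snd q)) T) (snd (snd q)) (fst q))) :: ennreal"
  have sel [measurable]: "(\<lambda>q. fst (snd q)) \<in> borel_measurable (path_algebra \<Otimes>\<^sub>M (borel :: (real \<times> real) measure))"
    "(\<lambda>q. snd (snd q)) \<in> borel_measurable (path_algebra \<Otimes>\<^sub>M (borel :: (real \<times> real) measure))"
    by (simp_all add: borel_prod[symmetric])
  have [measurable]: "(\<lambda>q. W (min (fst (snd q)) T) (fst q)) \<in> borel_measurable (path_algebra \<Otimes>\<^sub>M (borel :: (real \<times> real) measure))"
  proof -
    have "(\<lambda>q. (fst q, min (fst (snd q)) T)) \<in> measurable (path_algebra \<Otimes>\<^sub>M (borel :: (real \<times> real) measure)) (path_algebra \<Otimes>\<^sub>M borel)"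
      by measurable
    from measurable_compose[OF this W_jointly_measurable] show ?thesis by simp
  qed
  have \<Phi>: "?\<Phi> \<in> borel_measurable (path_algebra \<Otimes>\<^sub>M borel)"
    unfolding brownian_bridge_def by measurable
  have "(\<integral>\<^sup>+\<omega>. indicator B \<omega> * (indicator {t<..} (\<nu> \<omega>) * \<psi> (Z \<omega>, \<zeta> t \<omega>)) \<partial>M) =
      (\<integral>\<^sup>+\<omega>. ?\<Phi> (\<omega>, \<tau> \<omega>, Z \<omega>) \<partial>M)"
  proof (rule nn_integral_cong)
    fix \<omega>
    show "indicator B \<omega> * (indicator {t<..} (\<nu> \<omega>) * \<psi> (Z \<omega>, \<zeta> t \<omega>)) = ?\<Phi> (\<omega>, \<tau> \<omega>, Z \<omega>)"
      using t_pos by (cases "t < \<nu> \<omega>") (simp_all add: \<zeta>_before, simp_all add: \<nu>_def)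
  qed
  also have "\<dots> = (\<integral>\<^sup>+\<omega>'. \<integral>\<^sup>+\<omega>. ?\<Phi> (\<omega>, \<tau> \<omega>', Z \<omega>') \<partial>M \<partial>M)"
    by (rule nn_integral_indep_pair[OF indep _ _ \<Phi>]) measurable
  also have "\<dots> = (\<integral>\<^sup>+\<omega>'. emeasure M B * (indicator {t<..} (\<nu> \<omega>') *
      (\<integral>\<^sup>+x. \<psi> (Z \<omega>', x) * bridge_density \<sigma> t (\<nu> \<omega>') (Z \<omega>') x \<partial>lborel)) \<partial>M)"
  proof (rule nn_integral_cong)
    fix \<omega>'
    show "(\<integral>\<^sup>+\<omega>. ?\<Phi> (\<omega>, \<tau> \<omega>', Z \<omega>') \<partial>M) = emeasure M B * (indicator {t<..} (\<nu> \<omega>') *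
      (\<integral>\<^sup>+x. \<psi> (Z \<omega>', x) * bridge_density \<sigma> t (\<nu> \<omega>') (Z \<omega>') x \<partial>lborel))"
    proof (cases "t < \<nu> \<omega>'")
      case True
      then show ?thesis
        using nn_integral_bridge[OF True B, of "\<lambda>x. \<psi> (Z \<omega>', x)" "Z \<omega>'"]
        by (simp add: \<nu>_def mult.commute)
    next
      case False
      then show ?thesis by (simp add: \<nu>_def)
    qed
  qed
  also have "\<dots> = emeasure M B * (\<integral>\<^sup>+\<omega>. indicator {t<..} (\<nu> \<omega>) *
      (\<integral>\<^sup>+x. \<psi> (Z \<omega>, x) * bridge_density \<sigma> t (\<nu> \<omega>) (Z \<omega>) x \<partial>lborel) \<partial>M)"
    by (intro nn_integral_cmult) measurable
  finally show ?thesis .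
qed

section \<open>The joint law of \<open>Z\<close> and \<open>\<zeta> t\<close> before default\<close>

lemma nn_integral_\<tau>_Z:
  fixes H :: "real \<times> real \<Rightarrow> ennreal"
  assumes [measurable]: "H \<in> borel_measurable borel"
  shows "(\<integral>\<^sup>+\<omega>. H (\<tau> \<omega>, Z \<omega>) \<partial>M) = (\<Sum>j=1..l. ennreal (p j) * (\<integral>\<^sup>+r. H (r, z j) * g j r \<partial>lborel))"
proof -
  let ?A = "\<lambda>j. {\<omega> \<in> space M. Z \<omega> = z j}"
  have "(\<integral>\<^sup>+\<omega>. H (\<tau> \<omega>, Z \<omega>) \<partial>M) = (\<integral>\<^sup>+\<omega>. (\<Sum>j=1..l. H (\<tau> \<omega>, z j) * indicator (?A j) \<omega>) \<partial>M)"
  proof (rule nn_integral_cong)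
    fix \<omega> assume \<omega>: "\<omega> \<in> space M"
    then obtain i where i: "i \<in> {1..l}" "Z \<omega> = z i" using Z_range by blast
    \<comment> \<open>Distinctness of the values \<open>z j\<close> leaves exactly one
      summand.\<close>
    have "(\<Sum>j=1..l. H (\<tau> \<omega>, z j) * indicator (?A j) \<omega>) = (\<Sum>j=1..l. if i = j then H (\<tau> \<omega>, z j) else 0)"
      using \<omega> i inj_onD[OF z_inj, of i] by (intro sum.cong) (auto simp: indicator_def)
    also have "\<dots> = H (\<tau> \<omega>, Z \<omega>)" using i by (simp add: sum.delta)
    finally show "H (\<tau> \<omega>, Z \<omega>) = (\<Sum>j=1..l. H (\<tau> \<omega>, z j) * indicator (?A j) \<omega>)" by simp
  qed
  also have "\<dots> = (\<Sum>j=1..l. \<integral>\<^sup>+\<omega>. H (\<tau> \<omega>, z j) * indicator (?A j) \<omega> \<partial>M)"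
    by (intro nn_integral_sum) measurable
  also have "\<dots> = (\<Sum>j=1..l. ennreal (p j) * (\<integral>\<^sup>+r. H (r, z j) * g j r \<partial>lborel))"
  proof (rule sum.cong[OF refl])
    fix j assume j: "j \<in> {1..l}"
    have A: "emeasure M (?A j) = ennreal (p j)" using p_eq[OF j] by (simp add: emeasure_eq_measure)
    have "(\<integral>\<^sup>+r. H (r, z j) * g j r \<partial>lborel) = (\<integral>\<^sup>+r. g j r * H (r, z j) \<partial>lborel)"
      by (simp add: mult.commute)
    also have "\<dots> = (\<integral>\<^sup>+\<omega>. H (\<tau> \<omega>, z j) \<partial>uniform_measure M (?A j))"
      using distributed_nn_integral[OF f_density[OF j], of "\<lambda>r. H (r, z j)"] by (simp add: g_def)
    also have "\<dots> = (\<integral>\<^sup>+\<omega>. H (\<tau> \<omega>, z j) * indicator (?A j) \<omega> \<partial>M) / ennreal (p j)"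
      by (subst nn_integral_uniform_measure) (simp_all add: A)
    finally show "(\<integral>\<^sup>+\<omega>. H (\<tau> \<omega>, z j) * indicator (?A j) \<omega> \<partial>M) = ennreal (p j) * (\<integral>\<^sup>+r. H (r, z j) * g j r \<partial>lborel)"
      using p_pos[OF j]
      by (simp add: ennreal_times_divide mult.commute[of "ennreal (p j)"] ennreal_mult_divide_eq)
  qed
  finally show ?thesis .
qed

text \<open>
  Integrating over \<open>min r T\<close> absorbs the term with \<open>tail_integral\<close> into the integral: \<open>q_nn j x\<close> is
  the numerator \<open>q j x\<close> of the pricing formula wherever it is finite.
\<close>

definition q_nn :: "nat \<Rightarrow> real \<Rightarrow> ennreal" where
  "q_nn j x = (\<integral>\<^sup>+r. indicator {t<..} r * bridge_density \<sigma> t (min r T) (z j) x * g j r \<partial>lborel)"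

definition q :: "nat \<Rightarrow> real \<Rightarrow> real" where
  "q j x = (LBINT r:{t<..T}. bridge_density \<sigma> t r (z j) x * f r (z j))
     + tail_integral f T (z j) * bridge_density \<sigma> t T (z j) x"

lemma nn_integral_before_mixture:
  assumes B: "B \<in> sigma_sets (space M) (process_events M {0..t} (brownian_bridge W t))"
    and \<psi> [measurable]: "\<psi> \<in> borel_measurable borel"
  shows "(\<integral>\<^sup>+\<omega>. indicator B \<omega> * (indicator {t<..} (\<nu> \<omega>) * \<psi> (Z \<omega>, \<zeta> t \<omega>)) \<partial>M) =
    emeasure M B * (\<Sum>j=1..l. ennreal (p j) * (\<integral>\<^sup>+x. \<psi> (z j, x) * q_nn j x \<partial>lborel))"
proof -
  let ?H = "\<lambda>y. indicator {t<..} (min (fst y) T) *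
      (\<integral>\<^sup>+x. \<psi> (snd y, x) * bridge_density \<sigma> t (min (fst y) T) (snd y) x \<partial>lborel)"
  have "?H \<in> borel_measurable (borel \<Otimes>\<^sub>M borel)" by measurable
  then have H: "?H \<in> borel_measurable borel" by (simp add: borel_prod)
  have "(\<integral>\<^sup>+\<omega>. indicator {t<..} (\<nu> \<omega>) *
      (\<integral>\<^sup>+x. \<psi> (Z \<omega>, x) * bridge_density \<sigma> t (\<nu> \<omega>) (Z \<omega>) x \<partial>lborel) \<partial>M) =
      (\<integral>\<^sup>+\<omega>. ?H (\<tau> \<omega>, Z \<omega>) \<partial>M)"
    by (simp add: \<nu>_def)
  also have "\<dots> = (\<Sum>j=1..l. ennreal (p j) * (\<integral>\<^sup>+r. ?H (r, z j) * g j r \<partial>lborel))"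
    by (rule nn_integral_\<tau>_Z[OF H])
  also have "\<dots> = (\<Sum>j=1..l. ennreal (p j) * (\<integral>\<^sup>+x. \<psi> (z j, x) * q_nn j x \<partial>lborel))"
  proof (intro sum.cong[OF refl] arg_cong2[where f="(*)"] refl)
    fix j assume j: "j \<in> {1..l}"
    note [measurable] = g_measurable[OF j]
    let ?k = "\<lambda>r x. \<psi> (z j, x) * (indicator {t<..} r * bridge_density \<sigma> t (min r T) (z j) x * g j r) :: ennreal"
    have "(\<integral>\<^sup>+r. ?H (r, z j) * g j r \<partial>lborel) = (\<integral>\<^sup>+r. \<integral>\<^sup>+x. ?k r x \<partial>lborel \<partial>lborel)"
    proof (rule nn_integral_cong)
      fix r :: real
      have "?H (r, z j) * g j r = (\<integral>\<^sup>+x. indicator {t<..} (min r T) *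
          (\<psi> (z j, x) * bridge_density \<sigma> t (min r T) (z j) x) * g j r \<partial>lborel)"
        by (simp add: nn_integral_cmult nn_integral_multc)
      \<comment> \<open>Since \<open>t < T\<close>, the numbers \<open>min r T\<close> and
        \<open>r\<close> exceed \<open>t\<close> simultaneously.\<close>
      also have "\<dots> = (\<integral>\<^sup>+x. ?k r x \<partial>lborel)"
        using t_less by (intro nn_integral_cong)
          (auto split: split_indicator simp: ennreal_mult g_nonneg[OF j] ac_simps)
      finally show "?H (r, z j) * g j r = (\<integral>\<^sup>+x. ?k r x \<partial>lborel)" .
    qed
    also have "\<dots> = (\<integral>\<^sup>+x. \<integral>\<^sup>+r. ?k r x \<partial>lborel \<partial>lborel)"
      by (rule lborel_pair.Fubini') measurable
    also have "\<dots> = (\<integral>\<^sup>+x. \<psi> (z j, x) * q_nn j x \<partial>lborel)"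
      unfolding q_nn_def by (intro nn_integral_cong nn_integral_cmult) measurable
    finally show "(\<integral>\<^sup>+r. ?H (r, z j) * g j r \<partial>lborel) = (\<integral>\<^sup>+x. \<psi> (z j, x) * q_nn j x \<partial>lborel)" .
  qed
  finally show ?thesis
    by (simp add: nn_integral_before_conditional[OF B \<psi>])
qed

lemma q_nn_measurable [measurable]: "j \<in> {1..l} \<Longrightarrow> q_nn j \<in> borel_measurable borel"
  unfolding q_nn_def[abs_def] by measurable

text \<open>As \<open>r\<close> decreases to \<open>t\<close>, the variance of
  \<open>bridge_density\<close> tends to 0 and the integrand may blow up. Instead of a pointwise
  estimate, the total mass is bounded: \<open>\<psi> = 1\<close> and \<open>B = space M\<close> give
  the probability of \<open>t < \<nu>\<close>.\<close>

lemma q_nn_finite: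
  assumes j: "j \<in> {1..l}"
  shows "AE x in lborel. q_nn j x < \<infinity>"
proof -
  have sp: "space M \<in> sigma_sets (space M) (process_events M {0..t} (brownian_bridge W t))"
    by (rule sigma_sets_top)
  have "ennreal (p j) * (\<integral>\<^sup>+x. q_nn j x \<partial>lborel) \<le>
      (\<Sum>j=1..l. ennreal (p j) * (\<integral>\<^sup>+x. q_nn j x \<partial>lborel))"
    using j by (intro member_le_sum) auto
  also have "\<dots> = (\<integral>\<^sup>+\<omega>. indicator (space M) \<omega> * (indicator {t<..} (\<nu> \<omega>) * 1) \<partial>M)"
    by (subst nn_integral_before_mixture[OF sp, of "\<lambda>_. 1"]) (simp_all add: emeasure_space_1)
  also have "\<dots> \<le> (\<integral>\<^sup>+\<omega>. 1 \<partial>M)"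
    by (intro nn_integral_mono) (auto split: split_indicator)
  also have "\<dots> < \<infinity>" by (simp add: emeasure_space_1)
  finally have "(\<integral>\<^sup>+x. q_nn j x \<partial>lborel) \<noteq> \<infinity>"
    using p_pos[OF j] by (auto simp: ennreal_mult_less_top)
  then have "AE x in lborel. q_nn j x \<noteq> \<infinity>"
    using q_nn_measurable[OF j] by (intro nn_integral_PInf_AE) auto
  then show ?thesis by eventually_elim (simp add: top.not_eq_extremum)
qed

lemma nn_integral_g_le:
  assumes j: "j \<in> {1..l}"
  shows "(\<integral>\<^sup>+r. g j r \<partial>lborel) \<le> 1"
proof -
  let ?A = "{\<omega> \<in> space M. Z \<omega> = z j}"
  have "emeasure M ?A \<noteq> 0" using p_eq[OF j] p_pos[OF j] by (simp add: emeasure_eq_measure)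
  then interpret U: prob_space "uniform_measure M ?A"
    by (intro prob_space_uniform_measure) auto
  have "(\<integral>\<^sup>+r. g j r \<partial>lborel) = (\<integral>\<^sup>+\<omega>. 1 \<partial>uniform_measure M ?A)"
    using distributed_nn_integral[OF f_density[OF j], of "\<lambda>_. 1"] by (simp add: g_def)
  also have "\<dots> \<le> 1" using U.emeasure_space_1 by simp
  finally show ?thesis .
qed

lemma tail_integral_eq:
  assumes j: "j \<in> {1..l}"
  shows "ennreal (tail_integral f T (z j)) = (\<integral>\<^sup>+r. indicator {T<..} r * ennreal (g j r) \<partial>lborel)"
proof -
  note [measurable] = g_measurable[OF j]
  have "tail_integral f T (z j) = (\<integral>r. indicator {T..} r * g j r \<partial>lborel)"
    unfolding tail_integral_def set_lebesgue_integral_def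
    using t_pos t_less by (intro Bochner_Integration.integral_cong) (auto simp: g_eq split: split_indicator)
  also have "\<dots> = enn2real (\<integral>\<^sup>+r. ennreal (indicator {T..} r * g j r) \<partial>lborel)"
    by (rule integral_eq_nn_integral) (auto simp: g_nonneg[OF j])
  also have "(\<integral>\<^sup>+r. ennreal (indicator {T..} r * g j r) \<partial>lborel) =
      (\<integral>\<^sup>+r. indicator {T<..} r * ennreal (g j r) \<partial>lborel)"
  \<comment> \<open>\<open>tail_integral\<close> includes the point \<open>T\<close>, whereas
    \<open>q_nn\<close> will be split into \<open>r \<le> T\<close> and \<open>r > T\<close>; the
    point is null.\<close>
  proof (rule nn_integral_cong_AE)
    show "AE r in lborel. ennreal (indicator {T..} r * g j r) = indicator {T<..} r * ennreal (g j r)"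
      using AE_lborel_singleton[of T] by eventually_elim (auto split: split_indicator)
  qed
  finally have eq: "tail_integral f T (z j) = enn2real (\<integral>\<^sup>+r. indicator {T<..} r * ennreal (g j r) \<partial>lborel)" .
  have "(\<integral>\<^sup>+r. indicator {T<..} r * ennreal (g j r) \<partial>lborel) \<le> (\<integral>\<^sup>+r. g j r \<partial>lborel)"
    by (intro nn_integral_mono) (auto split: split_indicator)
  also have "\<dots> \<le> 1" by (rule nn_integral_g_le[OF j])
  finally have "(\<integral>\<^sup>+r. indicator {T<..} r * ennreal (g j r) \<partial>lborel) < \<top>"
    by (rule le_less_trans) simp
  then show ?thesis unfolding eq by simp
qed

lemma tail_integral_nonneg: "j \<in> {1..l} \<Longrightarrow> 0 \<le> tail_integral f T (z j)"
  unfolding tail_integral_def set_lebesgue_integral_def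
  using t_pos t_less by (intro integral_nonneg_AE) (auto simp: f_nonneg split: split_indicator)

lemma q_alt:
  "q j x = (\<integral>r. indicator {t<..T} r * (bridge_density \<sigma> t r (z j) x * g j r) \<partial>lborel)
     + tail_integral f T (z j) * bridge_density \<sigma> t T (z j) x"
proof -
  have "(LBINT r:{t<..T}. bridge_density \<sigma> t r (z j) x * f r (z j)) =
      (\<integral>r. indicator {t<..T} r * (bridge_density \<sigma> t r (z j) x * g j r) \<partial>lborel)"
    unfolding set_lebesgue_integral_def
    using t_pos by (intro Bochner_Integration.integral_cong) (auto simp: g_eq split: split_indicator)
  then show ?thesis by (simp add: q_def)
qed

lemma q_measurable [measurable]:
  assumes j: "j \<in> {1..l}"
  shows "q j \<in> borel_measurable borel"
proof -
  note [measurable] = g_measurable[OF j]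
  show ?thesis unfolding q_alt[abs_def] by measurable
qed

lemma q_nonneg: "j \<in> {1..l} \<Longrightarrow> 0 \<le> q j x"
  unfolding q_alt by (intro add_nonneg_nonneg mult_nonneg_nonneg tail_integral_nonneg integral_nonneg_AE)
    (auto simp: g_nonneg)

text \<open>A Bochner integral is 0 when the integrand is not integrable, so the passage from
  \<open>q_nn\<close> to \<open>q\<close> is made only where \<open>q_nn\<close> is finite, which is
  almost everywhere.\<close>

lemma ennreal_q:
  assumes j: "j \<in> {1..l}"
  shows "AE x in lborel. ennreal (q j x) = q_nn j x"
  using q_nn_finite[OF j]
proof eventually_elim
  case (elim x)
  note [measurable] = g_measurable[OF j]
  \<comment> \<open>\<open>min r T\<close> is \<open>r\<close> on \<open>{t<..T}\<close> and the
    constant \<open>T\<close> beyond. The second range gathers the whole mass of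
    \<open>\<nu> = T\<close> into the tail term.\<close>
  let ?h = "\<lambda>r. indicator {t<..T} r * (bridge_density \<sigma> t r (z j) x * g j r)"
  let ?k = "\<lambda>r. bridge_density \<sigma> t T (z j) x * (indicator {T<..} r * ennreal (g j r))"
  have "q_nn j x = (\<integral>\<^sup>+r. ennreal (?h r) + ?k r \<partial>lborel)"
    unfolding q_nn_def using t_less
    by (intro nn_integral_cong) (auto simp: ennreal_mult g_nonneg[OF j] split: split_indicator)
  also have "\<dots> = (\<integral>\<^sup>+r. ennreal (?h r) \<partial>lborel) + (\<integral>\<^sup>+r. ?k r \<partial>lborel)"
    by (intro nn_integral_add) measurable
  also have "(\<integral>\<^sup>+r. ?k r \<partial>lborel) = ennreal (tail_integral f T (z j) * bridge_density \<sigma> t T (z j) x)"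
    by (simp add: nn_integral_cmult tail_integral_eq[OF j, symmetric] ennreal_mult
        tail_integral_nonneg[OF j] mult.commute)
  finally have eq: "q_nn j x = (\<integral>\<^sup>+r. ennreal (?h r) \<partial>lborel) +
      ennreal (tail_integral f T (z j) * bridge_density \<sigma> t T (z j) x)" .
  with elim have "(\<integral>\<^sup>+r. ennreal (?h r) \<partial>lborel) < \<top>" by simp
  moreover have "(\<integral>r. ?h r \<partial>lborel) = enn2real (\<integral>\<^sup>+r. ennreal (?h r) \<partial>lborel)"
    by (rule integral_eq_nn_integral) (auto simp: g_nonneg[OF j])
  ultimately have "ennreal (\<integral>r. ?h r \<partial>lborel) = (\<integral>\<^sup>+r. ennreal (?h r) \<partial>lborel)"
    by simp
  moreover have "0 \<le> (\<integral>r. ?h r \<partial>lborel)" by (intro integral_nonneg_AE) (auto simp: g_nonneg[OF j])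
  ultimately show ?case
    unfolding eq q_alt by (simp add: ennreal_plus tail_integral_nonneg[OF j])
qed

text \<open>For \<open>B = space M\<close> this says that \<open>q j x * p j\<close> is the density
  in \<open>x\<close> of \<open>\<zeta> t\<close> on the event that \<open>Z = z j\<close> and
  \<open>t < \<nu>\<close>; a general \<open>B\<close> contributes only its mass, so the past of the
  bridge tells nothing more.\<close>

lemma nn_integral_before:
  assumes B: "B \<in> sigma_sets (space M) (process_events M {0..t} (brownian_bridge W t))"
    and \<psi> [measurable]: "\<psi> \<in> borel_measurable borel"
  shows "(\<integral>\<^sup>+\<omega>. indicator B \<omega> * (indicator {t<..} (\<nu> \<omega>) * \<psi> (Z \<omega>, \<zeta> t \<omega>)) \<partial>M) =
    emeasure M B * (\<integral>\<^sup>+x. (\<Sum>j=1..l. \<psi> (z j, x) * ennreal (q j x * p j)) \<partial>lborel)"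
proof -
  have "ennreal (p j) * (\<integral>\<^sup>+x. \<psi> (z j, x) * q_nn j x \<partial>lborel) =
      (\<integral>\<^sup>+x. \<psi> (z j, x) * ennreal (q j x * p j) \<partial>lborel)" if j: "j \<in> {1..l}" for j
  proof -
    note [measurable] = q_nn_measurable[OF j]
    have "ennreal (p j) * (\<integral>\<^sup>+x. \<psi> (z j, x) * q_nn j x \<partial>lborel) =
        (\<integral>\<^sup>+x. ennreal (p j) * (\<psi> (z j, x) * q_nn j x) \<partial>lborel)"
      by (intro nn_integral_cmult[symmetric]) measurable
    also have "\<dots> = (\<integral>\<^sup>+x. \<psi> (z j, x) * ennreal (q j x * p j) \<partial>lborel)"
    proof (rule nn_integral_cong_AE)
      show "AE x in lborel. ennreal (p j) * (\<psi> (z j, x) * q_nn j x) = \<psi> (z j, x) * ennreal (q j x * p j)"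
        using ennreal_q[OF j]
        by eventually_elim (use p_pos[OF j] q_nonneg[OF j] in \<open>simp add: ennreal_mult ac_simps\<close>)
    qed
    finally show ?thesis .
  qed
  moreover have "(\<integral>\<^sup>+x. (\<Sum>j=1..l. \<psi> (z j, x) * ennreal (q j x * p j)) \<partial>lborel) =
      (\<Sum>j=1..l. \<integral>\<^sup>+x. \<psi> (z j, x) * ennreal (q j x * p j) \<partial>lborel)"
    by (intro nn_integral_sum) measurable
  ultimately show ?thesis
    by (simp add: nn_integral_before_mixture[OF B \<psi>])
qed

end

section \<open>The conditional expectation\<close>

context market_information
begin

text \<open>Posterior probability of \<open>Z = z i\<close> given \<open>t < \<nu>\<close> and
  \<open>\<zeta> t = x\<close>. Where the total density vanishes, division by zero makes it
  0.\<close>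

definition weight :: "nat \<Rightarrow> real \<Rightarrow> real" where
  "weight i x = q i x / (\<Sum>j=1..l. q j x * p j) * p i"

definition filtered :: "real \<Rightarrow> real" where
  "filtered x = (\<Sum>i=1..l. z i * weight i x)"

text \<open>The error of the filter, cut off at default because from then on
  \<open>\<zeta> t\<close> reveals \<open>Z\<close> and the candidate for the conditional
  expectation is exact.\<close>

definition residual :: "'a \<Rightarrow> real" where
  "residual \<omega> = indicator {t<..} (\<nu> \<omega>) * (Z \<omega> - filtered (\<zeta> t \<omega>))"

lemma qp_nonneg: "i \<in> {1..l} \<Longrightarrow> 0 \<le> q i x * p i"
  by (intro mult_nonneg_nonneg q_nonneg less_imp_le p_pos)

lemma weight_nonneg: "i \<in> {1..l} \<Longrightarrow> 0 \<le> weight i x"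
  unfolding weight_def
  by (intro mult_nonneg_nonneg divide_nonneg_nonneg sum_nonneg q_nonneg less_imp_le p_pos)

text \<open>At a zero total all the nonnegative summands vanish, so the identity survives the
  convention for division by zero.\<close>

lemma weight_times_sum:
  assumes i: "i \<in> {1..l}"
  shows "weight i x * (\<Sum>j=1..l. q j x * p j) = q i x * p i"
proof (cases "(\<Sum>j=1..l. q j x * p j) = 0")
  case True
  then have "q i x * p i = 0"
    using i qp_nonneg by (subst (asm) sum_nonneg_eq_0_iff) auto
  with True show ?thesis by simp
qed (simp add: weight_def)

lemma weight_le_1:
  assumes i: "i \<in> {1..l}"
  shows "weight i x \<le> 1"
proof -
  have "q i x * p i \<le> (\<Sum>j=1..l. q j x * p j)"
    using i qp_nonneg by (intro member_le_sum) auto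
  moreover have "0 \<le> q i x * p i" using i by (rule qp_nonneg)
  ultimately show ?thesis by (auto simp: weight_def divide_le_eq_1)
qed

lemma weight_measurable [measurable]:
  assumes "i \<in> {1..l}"
  shows "weight i \<in> borel_measurable borel"
proof -
  have "(\<lambda>x. \<Sum>j=1..l. q j x * p j) \<in> borel_measurable borel"
    by (intro borel_measurable_sum) measurable
  with q_measurable[OF assms] show ?thesis unfolding weight_def[abs_def] by measurable
qed

lemma filtered_measurable [measurable]: "filtered \<in> borel_measurable borel"
  unfolding filtered_def[abs_def] by (intro borel_measurable_sum) measurable

lemma abs_filtered_le: "\<bar>filtered x\<bar> \<le> (\<Sum>i=1..l. \<bar>z i\<bar>)"
proof -
  have "\<bar>filtered x\<bar> \<le> (\<Sum>i=1..l. \<bar>z i * weight i x\<bar>)"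
    unfolding filtered_def by (rule sum_abs)
  also have "\<dots> \<le> (\<Sum>i=1..l. \<bar>z i\<bar>)"
    by (intro sum_mono) (auto simp: abs_mult weight_nonneg weight_le_1 intro!: mult_left_le)
  finally show ?thesis .
qed

lemma integrable_Z: "integrable M Z"
proof (rule integrable_const_bound[where B="\<Sum>i=1..l. \<bar>z i\<bar>"])
  show "AE \<omega> in M. norm (Z \<omega>) \<le> (\<Sum>i=1..l. \<bar>z i\<bar>)"
  proof (rule AE_I2)
    fix \<omega> assume "\<omega> \<in> space M"
    then obtain i where "i \<in> {1..l}" "Z \<omega> = z i" using Z_range by blast
    then show "norm (Z \<omega>) \<le> (\<Sum>i=1..l. \<bar>z i\<bar>)"
      using member_le_sum[of i "{1..l}" "\<lambda>i. \<bar>z i\<bar>"] by simp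
  qed
qed measurable

lemma integrable_residual: "integrable M residual"
proof -
  have "integrable M (\<lambda>\<omega>. filtered (\<zeta> t \<omega>))"
    by (rule integrable_const_bound[where B="\<Sum>i=1..l. \<bar>z i\<bar>"]) (auto simp: abs_filtered_le simp del: One_nat_def)
  then have "integrable M (\<lambda>\<omega>. indicator {\<omega> \<in> space M. t < \<nu> \<omega>} \<omega> *\<^sub>R (Z \<omega> - filtered (\<zeta> t \<omega>)))"
    using integrable_Z by (intro integrable_mult_indicator) auto
  then show ?thesis
    by (rule Bochner_Integration.integrable_cong[THEN iffD1, rotated -1])
       (auto simp: residual_def split: split_indicator)
qed

text \<open>By \<open>nn_integral_before\<close> both integrals equal \<open>emeasure M B\<close>
  times the integral of \<open>q i x * p i\<close> over \<open>C\<close>: on one side the indicator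
  keeps the index \<open>i\<close>, on the other the weight cancels the total density.\<close>

lemma integral_posterior_weight:
  assumes B: "B \<in> sigma_sets (space M) (process_events M {0..t} (brownian_bridge W t))"
    and [measurable]: "C \<in> sets borel" and i: "i \<in> {1..l}"
  defines "E \<equiv> \<lambda>\<omega>. indicator B \<omega> * (indicator {t<..} (\<nu> \<omega>) * indicator C (\<zeta> t \<omega>)) :: real"
  shows "integrable M (\<lambda>\<omega>. E \<omega> * indicator {z i} (Z \<omega>))" (is ?i1)
    and "integrable M (\<lambda>\<omega>. E \<omega> * weight i (\<zeta> t \<omega>))" (is ?i2)
    and "(\<integral>\<omega>. E \<omega> * indicator {z i} (Z \<omega>) \<partial>M) = (\<integral>\<omega>. E \<omega> * weight i (\<zeta> t \<omega>) \<partial>M)" (is ?eq)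
proof -
  note [measurable] = weight_measurable[OF i]
  have [measurable]: "B \<in> events"
    using B indep_setD_ev1[OF bridge_indep_endpoint[OF t_pos]] by blast
  have [measurable]: "E \<in> borel_measurable M" unfolding E_def by measurable
  have E: "0 \<le> E \<omega>" "E \<omega> \<le> 1" for \<omega> by (auto simp: E_def split: split_indicator)
  show ?i1
    by (rule integrable_const_bound[where B=1]) (auto simp: E split: split_indicator)
  show ?i2
    by (rule integrable_const_bound[where B=1])
       (auto simp: abs_mult E weight_nonneg[OF i] weight_le_1[OF i] intro!: mult_le_one)
  let ?\<psi>1 = "\<lambda>y::real \<times> real. indicator {z i} (fst y) * indicator C (snd y) :: ennreal"
  let ?\<psi>2 = "\<lambda>y::real \<times> real. indicator C (snd y) * ennreal (weight i (snd y))"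
  have "?\<psi>1 \<in> borel_measurable (borel \<Otimes>\<^sub>M borel)" "?\<psi>2 \<in> borel_measurable (borel \<Otimes>\<^sub>M borel)"
    by measurable
  then have \<psi>: "?\<psi>1 \<in> borel_measurable borel" "?\<psi>2 \<in> borel_measurable borel"
    by (simp_all add: borel_prod)
  have s1: "(\<Sum>j=1..l. ?\<psi>1 (z j, x) * ennreal (q j x * p j)) = indicator C x * ennreal (q i x * p i)" for x
  proof -
    have "(\<Sum>j=1..l. ?\<psi>1 (z j, x) * ennreal (q j x * p j)) =
        (\<Sum>j=1..l. if i = j then indicator C x * ennreal (q j x * p j) else 0)"
      using i inj_onD[OF z_inj, of i] by (intro sum.cong) (auto simp: indicator_def)
    with i show ?thesis by (simp add: sum.delta)
  qed
  have s2: "(\<Sum>j=1..l. ?\<psi>2 (z j, x) * ennreal (q j x * p j)) = indicator C x * ennreal (q i x * p i)" for x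
  proof -
    have *: "(\<Sum>j=1..l. ennreal (q j x * p j)) = ennreal (\<Sum>j=1..l. q j x * p j)"
      by (rule sum_ennreal) (rule qp_nonneg)
    have "(\<Sum>j=1..l. ?\<psi>2 (z j, x) * ennreal (q j x * p j)) =
        indicator C x * (ennreal (weight i x) * ennreal (\<Sum>j=1..l. q j x * p j))"
      unfolding *[symmetric] by (simp add: sum_distrib_left[symmetric] mult.assoc)
    also have "ennreal (weight i x) * ennreal (\<Sum>j=1..l. q j x * p j) = ennreal (q i x * p i)"
      unfolding weight_times_sum[OF i, symmetric]
      by (intro ennreal_mult[symmetric] weight_nonneg i sum_nonneg qp_nonneg)
    finally show ?thesis .
  qed
  have "(\<integral>\<^sup>+\<omega>. ennreal (E \<omega> * indicator {z i} (Z \<omega>)) \<partial>M) =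
      (\<integral>\<^sup>+\<omega>. indicator B \<omega> * (indicator {t<..} (\<nu> \<omega>) * ?\<psi>1 (Z \<omega>, \<zeta> t \<omega>)) \<partial>M)"
    by (intro nn_integral_cong) (auto simp: E_def split: split_indicator)
  also have "\<dots> = (\<integral>\<^sup>+\<omega>. indicator B \<omega> * (indicator {t<..} (\<nu> \<omega>) * ?\<psi>2 (Z \<omega>, \<zeta> t \<omega>)) \<partial>M)"
    by (simp only: nn_integral_before[OF B \<psi>(1)] nn_integral_before[OF B \<psi>(2)] s1 s2)
  also have "\<dots> = (\<integral>\<^sup>+\<omega>. ennreal (E \<omega> * weight i (\<zeta> t \<omega>)) \<partial>M)"
    by (intro nn_integral_cong) (auto simp: E_def split: split_indicator)
  finally show ?eq
    by (subst (1 2) integral_eq_nn_integral) (auto simp: E weight_nonneg[OF i])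
qed

lemma residual_orthogonal_basic:
  assumes B: "B \<in> sigma_sets (space M) (process_events M {0..t} (brownian_bridge W t))"
    and C [measurable]: "C \<in> sets borel"
  shows "(LINT \<omega>:B \<inter> (\<zeta> t -` C \<inter> space M)|M. residual \<omega>) = 0"
proof -
  let ?E = "\<lambda>\<omega>. indicator B \<omega> * (indicator {t<..} (\<nu> \<omega>) * indicator C (\<zeta> t \<omega>)) :: real"
  note w = integral_posterior_weight[OF B C]
  have "(LINT \<omega>:B \<inter> (\<zeta> t -` C \<inter> space M)|M. residual \<omega>) =
      (\<integral>\<omega>. (\<Sum>i=1..l. z i * (?E \<omega> * indicator {z i} (Z \<omega>) - ?E \<omega> * weight i (\<zeta> t \<omega>))) \<partial>M)"
    unfolding set_lebesgue_integral_def
  proof (rule Bochner_Integration.integral_cong[OF refl])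
    fix \<omega> assume \<omega>: "\<omega> \<in> space M"
    then obtain k where k: "k \<in> {1..l}" "Z \<omega> = z k" using Z_range by blast
    \<comment> \<open>The \<open>z i\<close> may be negative, whereas the comparison of the weights
      rests on nonnegative integrals; hence \<open>Z\<close> is expanded into indicators, with the
      \<open>z i\<close> as outer constants.\<close>
    have "(\<Sum>i=1..l. z i * indicator {z i} (Z \<omega>)) = (\<Sum>i=1..l. if k = i then z i else 0)"
      using k inj_onD[OF z_inj, of k] by (intro sum.cong) (auto simp: indicator_def)
    then have Z: "(\<Sum>i=1..l. z i * indicator {z i} (Z \<omega>)) = Z \<omega>" using k by (simp add: sum.delta)
    have factor: "a * (e * x - e * w) = e * (a * x - a * w)" for a e x w :: real
      by (simp add: algebra_simps)
    have "(\<Sum>i=1..l. z i * (?E \<omega> * indicator {z i} (Z \<omega>) - ?E \<omega> * weight i (\<zeta> t \<omega>))) =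
        ?E \<omega> * ((\<Sum>i=1..l. z i * indicator {z i} (Z \<omega>)) - (\<Sum>i=1..l. z i * weight i (\<zeta> t \<omega>)))"
      unfolding sum_subtractf[symmetric] sum_distrib_left
      by (rule sum.cong[OF refl], rule factor)
    also have "\<dots> = indicator (B \<inter> (\<zeta> t -` C \<inter> space M)) \<omega> *\<^sub>R residual \<omega>"
      using \<omega> unfolding Z by (auto simp: residual_def filtered_def split: split_indicator)
    finally show "indicator (B \<inter> (\<zeta> t -` C \<inter> space M)) \<omega> *\<^sub>R residual \<omega> =
      (\<Sum>i=1..l. z i * (?E \<omega> * indicator {z i} (Z \<omega>) - ?E \<omega> * weight i (\<zeta> t \<omega>)))" by simp
  qed
  also have "\<dots> = (\<Sum>i=1..l. \<integral>\<omega>. z i * (?E \<omega> * indicator {z i} (Z \<omega>) - ?E \<omega> * weight i (\<zeta> t \<omega>)) \<partial>M)"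
    by (intro Bochner_Integration.integral_sum integrable_mult_right Bochner_Integration.integrable_diff w)
  also have "\<dots> = 0"
  proof (rule sum.neutral, rule ballI)
    fix i assume i: "i \<in> {1..l}"
    show "(\<integral>\<omega>. z i * (?E \<omega> * indicator {z i} (Z \<omega>) - ?E \<omega> * weight i (\<zeta> t \<omega>)) \<partial>M) = 0"
      using w[OF i] by (subst integral_mult_right_zero, subst Bochner_Integration.integral_diff) simp_all
  qed
  finally show ?thesis .
qed

text \<open>
  Up to null sets, the filtration of \<open>\<zeta>\<close> at time \<open>t\<close> and the events generated here have the same
  trace on \<open>t < \<nu>\<close>; see \<open>\<zeta>_before_decomp\<close>.
\<close>

definition generating_events :: "'a set set" where
  "generating_events = {B \<inter> (\<zeta> t -` C \<inter> space M) |B C.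
     B \<in> sigma_sets (space M) (process_events M {0..t} (brownian_bridge W t)) \<and> C \<in> sets borel}"

lemma generating_events_Pow: "generating_events \<subseteq> Pow (space M)"
  by (auto simp: generating_events_def)

lemma generating_events_subset: "sigma_sets (space M) generating_events \<subseteq> events"
proof (rule sets.sigma_sets_subset)
  show "generating_events \<subseteq> events"
    using indep_setD_ev1[OF bridge_indep_endpoint[OF t_pos]]
    by (auto simp: generating_events_def intro!: sets.Int[OF _ measurable_sets[OF \<zeta>_measurable]])
qed

lemma residual_orthogonal:
  assumes "A \<in> sigma_sets (space M) generating_events"
  shows "(LINT \<omega>:A|M. residual \<omega>) = 0"
proof -
  interpret B: sigma_algebra "space M" "sigma_sets (space M) (process_events M {0..t} (brownian_bridge W t))"
    by (intro sigma_algebra_sigma_sets process_events_Pow)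
  have int: "set_integrable M A residual" if "A \<in> events" for A
    unfolding set_integrable_def using that integrable_residual by (rule integrable_mult_indicator)
  \<comment> \<open>The step for complements subtracts from the integral over the whole space, which
    is the basic case with the sure event and \<open>UNIV\<close>.\<close>
  have total: "(\<integral>\<omega>. residual \<omega> \<partial>M) = 0"
    using residual_orthogonal_basic[OF B.top space_in_borel]
      set_integral_space[OF integrable_residual] by simp
  have stable: "Int_stable generating_events"
  proof (rule Int_stableI)
    fix a b assume "a \<in> generating_events" "b \<in> generating_events"
    then obtain B C B' C' where
      "B \<in> sigma_sets (space M) (process_events M {0..t} (brownian_bridge W t))" "C \<in> sets borel"
      "B' \<in> sigma_sets (space M) (process_events M {0..t} (brownian_bridge W t))" "C' \<in> sets borel"
      "a = B \<inter> (\<zeta> t -` C \<inter> space M)" "b = B' \<inter> (\<zeta> t -` C' \<inter> space M)"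
      unfolding generating_events_def by blast
    then show "a \<inter> b \<in> generating_events"
      unfolding generating_events_def
      by (intro CollectI exI[of _ "B \<inter> B'"] exI[of _ "C \<inter> C'"]) (auto intro: B.Int)
  qed
  show ?thesis
    using stable generating_events_Pow assms
  proof (induction rule: sigma_sets_induct_disjoint)
    case (basic A)
    then obtain B C where "B \<in> sigma_sets (space M) (process_events M {0..t} (brownian_bridge W t))"
      "C \<in> sets borel" "A = B \<inter> (\<zeta> t -` C \<inter> space M)"
      unfolding generating_events_def by blast
    then show ?case by (simp add: residual_orthogonal_basic)
  next
    case empty
    then show ?case by (simp add: set_lebesgue_integral_def)
  next
    case (compl A)
    then have A: "A \<in> events" using generating_events_subset by blast
    have "(LINT \<omega>:A \<union> (space M - A)|M. residual \<omega>) =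
        (LINT \<omega>:A|M. residual \<omega>) + (LINT \<omega>:space M - A|M. residual \<omega>)"
      using A by (intro set_integral_Un int) auto
    moreover have "A \<union> (space M - A) = space M" using sets.sets_into_space[OF A] by auto
    ultimately show ?case
      using compl total set_integral_space[OF integrable_residual] by simp
  next
    case (union A)
    then have A: "A i \<in> events" for i using generating_events_subset by blast
    have "(LINT \<omega>:(\<Union>i. A i)|M. residual \<omega>) = (\<Sum>i. (LINT \<omega>:A i|M. residual \<omega>))"
      using union.hyps A by (intro lebesgue_integral_countable_add int) (auto simp: disjoint_family_on_def)
    then show ?case using union by simp
  qed
qed

text \<open>By \<open>nn_integral_before\<close>, \<open>\<zeta> t\<close> has a Lebesgue density on
  \<open>t < \<nu>\<close>, and a finite set is Lebesgue null.\<close>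

lemma \<zeta>_before_avoids_atoms:
  "AE \<omega> in M. t < \<nu> \<omega> \<longrightarrow> \<zeta> t \<omega> \<notin> (\<lambda>i. \<sigma> * z i) ` {1..l}"
proof -
  let ?S = "(\<lambda>i. \<sigma> * z i) ` {1..l}"
  have S [measurable]: "?S \<in> sets borel"
    by (rule borel_closed) (simp add: finite_imp_closed)
  have "(\<lambda>y::real \<times> real. indicator ?S (snd y) :: ennreal) \<in> borel_measurable (borel \<Otimes>\<^sub>M borel)"
    by measurable
  then have \<psi>: "(\<lambda>y::real \<times> real. indicator ?S (snd y) :: ennreal) \<in> borel_measurable borel"
    by (simp add: borel_prod)
  have "AE x in lborel. x \<notin> ?S"
    by (intro AE_not_in finite_imp_null_set_lborel) simp
  then have "AE x in lborel. (\<Sum>j=1..l. indicator ?S x * ennreal (q j x * p j)) = 0"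
    by eventually_elim simp
  then have "(\<integral>\<^sup>+x. (\<Sum>j=1..l. indicator ?S x * ennreal (q j x * p j)) \<partial>lborel) = (\<integral>\<^sup>+(x::real). 0 \<partial>lborel)"
    by (rule nn_integral_cong_AE)
  then have "(\<integral>\<^sup>+\<omega>. indicator (space M) \<omega> * (indicator {t<..} (\<nu> \<omega>) * indicator ?S (\<zeta> t \<omega>)) \<partial>M) = 0"
    using nn_integral_before[OF sigma_sets_top \<psi>] by simp
  then have "AE \<omega> in M. indicator (space M) \<omega> * (indicator {t<..} (\<nu> \<omega>) * indicator ?S (\<zeta> t \<omega>)) = (0 :: ennreal)"
    by (subst (asm) nn_integral_0_iff_AE) measurable
  then show ?thesis using AE_space
    by eventually_elim (auto split: split_indicator_asm)
qed

text \<open>\<open>X\<close> stands for the process built from the original paths. On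
  \<open>t < \<nu>\<close> the value \<open>X s\<close> is almost surely a function of
  \<open>\<zeta> t\<close> and the bridge at \<open>s\<close>; this settles the generators, and
  \<open>sigma_sets_AE_transfer\<close> does the rest.\<close>

lemma trace_on_before:
  assumes X: "AE \<omega> in M. \<forall>s\<in>{0..t}. X s \<omega> = \<zeta> s \<omega>"
    and A: "A \<in> sigma_sets (space M) (process_events M {0..t} X \<union> null_sets M)"
  shows "\<exists>A'\<in>sigma_sets (space M) generating_events. AE \<omega> in M. t < \<nu> \<omega> \<longrightarrow> (\<omega> \<in> A \<longleftrightarrow> \<omega> \<in> A')"
proof (rule sigma_sets_AE_transfer[OF _ A])
  let ?N = "sigma (space M) generating_events"
  have N: "space ?N = space M" "sets ?N = sigma_sets (space M) generating_events"
    using generating_events_Pow by (simp_all add: space_measure_of_conv)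
  interpret B: sigma_algebra "space M" "sigma_sets (space M) (process_events M {0..t} (brownian_bridge W t))"
    by (intro sigma_algebra_sigma_sets process_events_Pow)
  have \<zeta>N [measurable]: "\<zeta> t \<in> borel_measurable ?N"
  proof (rule measurableI)
    fix C :: "real set" assume "C \<in> sets borel"
    then have "space M \<inter> (\<zeta> t -` C \<inter> space M) \<in> generating_events"
      unfolding generating_events_def using B.top by blast
    then show "\<zeta> t -` C \<inter> space ?N \<in> sets ?N"
      unfolding N by (intro sigma_sets.Basic) (simp add: Int_absorb1)
  qed simp
  have BN: "brownian_bridge W t s \<in> borel_measurable ?N" if "s \<in> {0..t}" for s
  proof (rule measurableI)
    fix C :: "real set" assume "C \<in> sets borel"
    then have "brownian_bridge W t s -` C \<inter> space M \<in>
        sigma_sets (space M) (process_events M {0..t} (brownian_bridge W t))"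
      using that by (intro sigma_sets.Basic process_eventsI)
    then have "(brownian_bridge W t s -` C \<inter> space M) \<inter> (\<zeta> t -` UNIV \<inter> space M) \<in> generating_events"
      unfolding generating_events_def using space_in_borel by blast
    moreover have "(brownian_bridge W t s -` C \<inter> space M) \<inter> (\<zeta> t -` UNIV \<inter> space M) =
        brownian_bridge W t s -` C \<inter> space M" by auto
    ultimately have "brownian_bridge W t s -` C \<inter> space M \<in> generating_events"
      by (simp only:)
    then show "brownian_bridge W t s -` C \<inter> space ?N \<in> sets ?N"
      unfolding N by (rule sigma_sets.Basic)
  qed simp
  fix a assume "a \<in> process_events M {0..t} X \<union> null_sets M"
  then consider s C where "s \<in> {0..t}" "C \<in> sets borel" "a = X s -` C \<inter> space M" | "a \<in> null_sets M"
    unfolding process_events_def by blast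
  then show "\<exists>b\<in>sigma_sets (space M) generating_events. AE \<omega> in M. t < \<nu> \<omega> \<longrightarrow> (\<omega> \<in> a \<longleftrightarrow> \<omega> \<in> b)"
  proof cases
    case 1
    note [measurable] = BN[OF 1(1)] 1(2)
    let ?Y = "\<lambda>\<omega>. s / t * \<zeta> t \<omega> + brownian_bridge W t s \<omega>"
    have "?Y -` C \<inter> space ?N \<in> sets ?N" by measurable
    moreover have "AE \<omega> in M. t < \<nu> \<omega> \<longrightarrow> (\<omega> \<in> a \<longleftrightarrow> \<omega> \<in> ?Y -` C \<inter> space ?N)"
      using X
    proof eventually_elim
      case (elim \<omega>)
      then show ?case
        using 1 \<zeta>_before_decomp[of s \<omega>] by (auto simp: N(1))
    qed
    ultimately show ?thesis unfolding N(2) by blast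
  next
    case 2
    \<comment> \<open>A null generator is matched with the empty event, so the completion leaves no
      trace in \<open>generating_events\<close>.\<close>
    then have "AE \<omega> in M. t < \<nu> \<omega> \<longrightarrow> (\<omega> \<in> a \<longleftrightarrow> \<omega> \<in> {})"
      using AE_not_in[of a M] by auto
    then show ?thesis by (intro bexI[of _ "{}"] sigma_sets.Empty)
  qed
qed

lemma real_cond_exp_cash_flow:
  assumes X: "AE \<omega> in M. \<forall>s\<in>{0..t}. X s \<omega> = \<zeta> s \<omega>"
    and Xm: "\<And>s. s \<in> {0..t} \<Longrightarrow> X s \<in> borel_measurable M"
  shows "AE \<omega> in M. real_cond_exp M (completed_natural_filtration M X t) Z \<omega> =
    Z \<omega> * indicator {\<omega>. \<nu> \<omega> \<le> t} \<omega> + filtered (X t \<omega>) * indicator {\<omega>. t < \<nu> \<omega>} \<omega>"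
proof -
  let ?F = "completed_natural_filtration M X t"
  let ?P = "process_events M {0..t} X \<union> null_sets M"
  have Pev: "?P \<subseteq> events"
    using process_events_subset_sets[of "{0..t}" X M] Xm by auto
  then have PPow: "?P \<subseteq> Pow (space M)"
    using sets.space_closed by blast
  have F: "space ?F = space M" "sets ?F = sigma_sets (space M) ?P"
    using PPow by (simp_all add: completed_natural_filtration_def space_measure_of_conv)
  have "subalgebra M ?F"
    unfolding subalgebra_def F using sets.sigma_sets_subset[OF Pev] by simp
  then interpret F: finite_measure_subalgebra M ?F
    by unfold_locales
  let ?S = "(\<lambda>i. \<sigma> * z i) ` {1..l}"
  have S [measurable]: "?S \<in> sets borel"
    by (rule borel_closed) (simp add: finite_imp_closed)
  \<comment> \<open>The candidate is a function of \<open>X t\<close> alone and hence measurable for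
    the filtration, without deciding beforehand whether \<open>\<nu> \<le> t\<close> is an event of
    it. On \<open>?S\<close> the value has the form \<open>\<sigma> * Z\<close>, and dividing by
    \<open>\<sigma>\<close> recovers \<open>Z\<close>.\<close>
  define K where "K x = (if x \<in> ?S then x / \<sigma> else filtered x)" for x
  have [measurable]: "K \<in> borel_measurable borel"
    unfolding K_def[abs_def] by measurable
  have "X t \<in> borel_measurable ?F"
    unfolding completed_natural_filtration_def
    by (rule measurable_process_events[where I="{0..t}", OF _ sigma_sets_mono' PPow])
       (use t_pos in auto)
  then have KF: "(\<lambda>\<omega>. K (X t \<omega>)) \<in> borel_measurable ?F" by measurable
  have K: "AE \<omega> in M. K (X t \<omega>) =
      Z \<omega> * indicator {\<omega>. \<nu> \<omega> \<le> t} \<omega> + filtered (X t \<omega>) * indicator {\<omega>. t < \<nu> \<omega>} \<omega>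
      \<and> K (X t \<omega>) = Z \<omega> - residual \<omega>"
    using X \<zeta>_before_avoids_atoms AE_space
  proof eventually_elim
    case (elim \<omega>)
    then have Xt: "X t \<omega> = \<zeta> t \<omega>" using t_pos by auto
    show ?case
    proof (cases "t < \<nu> \<omega>")
      case True
      with elim Xt show ?thesis by (simp add: K_def residual_def)
    next
      case False
      with elim have "X t \<omega> = \<sigma> * Z \<omega>" "X t \<omega> \<in> ?S"
        using Xt \<zeta>_after[of \<omega> t] Z_range[of \<omega>] by auto
      with False \<sigma>_pos show ?thesis by (simp add: K_def residual_def)
    qed
  qed
  have intK: "integrable M (\<lambda>\<omega>. K (X t \<omega>))"
  proof (rule integrable_cong_AE_imp)
    show "integrable M (\<lambda>\<omega>. Z \<omega> - residual \<omega>)"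
      using integrable_Z integrable_residual by simp
    show "(\<lambda>\<omega>. K (X t \<omega>)) \<in> borel_measurable M"
      using Xm[of t] t_pos by simp
    show "AE \<omega> in M. Z \<omega> - residual \<omega> = K (X t \<omega>)"
      using K by eventually_elim simp
  qed
  have "AE \<omega> in M. real_cond_exp M ?F Z \<omega> = K (X t \<omega>)"
  proof (rule F.real_cond_exp_charact[OF _ integrable_Z intK KF])
    fix A assume A: "A \<in> sets ?F"
    then have Aev: "A \<in> events" using F.subalg by (auto simp: subalgebra_def)
    obtain A' where A': "A' \<in> sigma_sets (space M) generating_events"
      "AE \<omega> in M. t < \<nu> \<omega> \<longrightarrow> (\<omega> \<in> A \<longleftrightarrow> \<omega> \<in> A')"
      using trace_on_before[OF X A[unfolded F]] by blast
    have A'ev: "A' \<in> events" using A'(1) generating_events_subset by blast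
    have r [measurable]: "residual \<in> borel_measurable M" using integrable_residual by simp
    \<comment> \<open>\<open>A\<close> and \<open>A'\<close> may differ from default on, but there
      \<open>residual\<close> is 0.\<close>
    have "(LINT \<omega>:A|M. residual \<omega>) = (LINT \<omega>:A'|M. residual \<omega>)"
      unfolding set_lebesgue_integral_def
    proof (rule integral_cong_AE)
      show "AE \<omega> in M. indicator A \<omega> *\<^sub>R residual \<omega> = indicator A' \<omega> *\<^sub>R residual \<omega>"
        using A'(2) by eventually_elim (auto simp: residual_def split: split_indicator)
    qed (use Aev A'ev in measurable)
    also have "\<dots> = 0" by (rule residual_orthogonal[OF A'(1)])
    finally have 0: "(LINT \<omega>:A|M. residual \<omega>) = 0" .
    have "(LINT \<omega>:A|M. K (X t \<omega>)) = (LINT \<omega>:A|M. Z \<omega> - residual \<omega>)"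
      unfolding set_lebesgue_integral_def
    proof (rule integral_cong_AE)
      show "AE \<omega> in M. indicator A \<omega> *\<^sub>R K (X t \<omega>) = indicator A \<omega> *\<^sub>R (Z \<omega> - residual \<omega>)"
        using K by eventually_elim simp
      show "(\<lambda>\<omega>. indicator A \<omega> *\<^sub>R K (X t \<omega>)) \<in> borel_measurable M"
        using Aev intK by (intro borel_measurable_scaleR borel_measurable_indicator) auto
      show "(\<lambda>\<omega>. indicator A \<omega> *\<^sub>R (Z \<omega> - residual \<omega>)) \<in> borel_measurable M"
        using Aev by measurable
    qed
    also have "\<dots> = (LINT \<omega>:A|M. Z \<omega>) - (LINT \<omega>:A|M. residual \<omega>)"
    proof (rule set_integral_diff)
      show "set_integrable M A Z" "set_integrable M A residual"
        unfolding set_integrable_def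
        using integrable_mult_indicator[OF Aev] integrable_Z integrable_residual by blast+
    qed
    finally show "(LINT \<omega>:A|M. Z \<omega>) = (LINT \<omega>:A|M. K (X t \<omega>))" using 0 by simp
  qed
  then show ?thesis using K by eventually_elim simp
qed

end

section \<open>Return from the regular version to the given Brownian motion\<close>

lemma (in complete_measure) borel_measurable_cong_AE_complete:
  fixes X Y :: "'a \<Rightarrow> real"
  assumes Y: "Y \<in> borel_measurable M" and eq: "AE \<omega> in M. X \<omega> = Y \<omega>"
  shows "X \<in> borel_measurable M"
proof (rule measurableI)
  fix A :: "real set" assume "A \<in> sets borel"
  then have m: "Y -` A \<inter> space M \<in> sets M" using Y by (rule measurable_sets[rotated])
  \<comment> \<open>Completeness enters here: a set that agrees almost everywhere with a measurable
    set is measurable.\<close>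
  have "AE \<omega> in M. \<omega> \<in> Y -` A \<inter> space M \<longleftrightarrow> \<omega> \<in> X -` A \<inter> space M"
    using eq by eventually_elim auto
  from in_sets_AE[OF this m] show "X -` A \<inter> space M \<in> sets M" by auto
qed simp

theorem proposition3p1:
  fixes M :: "'a measure"
    and W :: "real \<Rightarrow> 'a \<Rightarrow> real"
    and \<tau> \<nu> Z :: "'a \<Rightarrow> real"
    and \<zeta> :: "real \<Rightarrow> 'a \<Rightarrow> real"
    and T \<sigma> t :: real
    and \<rho> :: "real \<Rightarrow> real"
    and l :: nat
    and z p :: "nat \<Rightarrow> real"
    and f :: "real \<Rightarrow> real \<Rightarrow> real"
  assumes "prob_space M" and "complete_measure M"
    and "T > 0" and "\<sigma> > 0"
    and "standard_brownian_motion M W"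
    and "\<tau> \<in> borel_measurable M" and "\<And>\<omega>. \<omega> \<in> space M \<Longrightarrow> \<tau> \<omega> > 0"
    and "Z \<in> borel_measurable M"
    and "process_indep_of_pair M {0..} W \<tau> Z"
    and "inj_on z {1..l}" and "\<And>\<omega>. \<omega> \<in> space M \<Longrightarrow> Z \<omega> \<in> z ` {1..l}"
    and "\<And>i. i \<in> {1..l} \<Longrightarrow> measure M {\<omega> \<in> space M. Z \<omega> = z i} = p i"
    and "\<And>i. i \<in> {1..l} \<Longrightarrow> p i > 0"
    and "(\<Sum>i=1..l. p i) = 1"
    and "measure M {\<omega> \<in> space M. \<tau> \<omega> \<le> T} < 1"
    and "\<And>i. i \<in> {1..l} \<Longrightarrow> continuous_on {0..} (\<lambda>r. f r (z i))"
    and "\<And>i r. i \<in> {1..l} \<Longrightarrow> r \<ge> 0 \<Longrightarrow> f r (z i) \<ge> 0"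
    and "\<And>i. i \<in> {1..l} \<Longrightarrow>
           distributed (uniform_measure M {\<omega> \<in> space M. Z \<omega> = z i}) lborel \<tau>
             (\<lambda>r. ennreal (indicator {0..} r * f r (z i)))"
    and "set_integrable lborel {0..T} \<rho>"
    and "\<nu> = (\<lambda>\<omega>. min (\<tau> \<omega>) T)"
    and "\<zeta> = information_process \<sigma> W \<nu> Z"
    and "0 < t" and "t < T"
  shows "AE \<omega> in M.
    bond_price \<rho> t T * real_cond_exp M (completed_natural_filtration M \<zeta> t) Z \<omega> =
      bond_price \<rho> t T * Z \<omega> * indicator {\<omega>. \<nu> \<omega> \<le> t} \<omega>
      + bond_price \<rho> t T *
        (\<Sum>i=1..l. z i *
           (((LBINT r:{t<..T}. bridge_density \<sigma> t r (z i) (\<zeta> t \<omega>) * f r (z i))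
              + tail_integral f T (z i) * bridge_density \<sigma> t T (z i) (\<zeta> t \<omega>))
            / (\<Sum>j=1..l.
                 ((LBINT r:{t<..T}. bridge_density \<sigma> t r (z j) (\<zeta> t \<omega>) * f r (z j))
                    + tail_integral f T (z j) * bridge_density \<sigma> t T (z j) (\<zeta> t \<omega>)) * p j))
           * p i * indicator {\<omega>. t < \<nu> \<omega>} \<omega>)"
proof -
  interpret complete_measure M by fact
  \<comment> \<open>A single null set serves all times \<open>s \<ge> 0\<close>; this is what allows
    the two processes to be compared at the random time \<open>\<nu>\<close>.\<close>
  obtain W' where W': "regular_brownian_motion M W'" and eq: "AE \<omega> in M. \<forall>s\<ge>0. W' s \<omega> = W s \<omega>"
    using regular_brownian_motion_version[OF assms(1,5)] .
  interpret R: regular_brownian_motion M W' by fact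
  have indep: "process_indep_of_pair M {0..} W' \<tau> Z"
    using eq by (intro process_indep_of_pair_cong_AE[OF assms(1,9)]) auto
  interpret I: market_information M W' \<tau> Z T \<sigma> t l z p f
    by unfold_locales (fact indep assms)+
  have \<nu>: "I.\<nu> = \<nu>" by (simp add: fun_eq_iff I.\<nu>_def assms(20))
  have "AE \<omega> in M. \<forall>s\<in>{0..t}. \<zeta> s \<omega> = I.\<zeta> s \<omega>"
    using eq AE_space
  proof eventually_elim
    case (elim \<omega>)
    \<comment> \<open>The two processes agree at nonnegative times only, and both are evaluated at
      \<open>\<nu>\<close>.\<close>
    have "0 \<le> \<nu> \<omega>" using assms(3,7,20) elim(2) by (auto simp: less_imp_le)
    then show ?case using elim by (auto simp: assms(21) I.\<zeta>_def \<nu> information_process_def)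
  qed
  note \<zeta>_eq = this
  \<comment> \<open>For the given paths joint measurability in time and \<open>\<omega>\<close> is
    not at hand, so the measurability of \<open>\<zeta> s\<close> is inherited from the regular
    version by completeness.\<close>
  have \<zeta>_measurable: "\<zeta> s \<in> borel_measurable M" if "s \<in> {0..t}" for s
    by (rule borel_measurable_cong_AE_complete[OF I.\<zeta>_measurable[of s]])
       (rule eventually_mono[OF \<zeta>_eq], use that in blast)
  have sum: "I.filtered x * c =
      (\<Sum>i=1..l. z i * (I.q i x / (\<Sum>j=1..l. I.q j x * p j)) * p i * c)" for x c
    unfolding I.filtered_def I.weight_def sum_distrib_right by (simp only: mult.assoc)
  have "AE \<omega> in M. real_cond_exp M (completed_natural_filtration M \<zeta> t) Z \<omega> =
      Z \<omega> * indicator {\<omega>. \<nu> \<omega> \<le> t} \<omega> + I.filtered (\<zeta> t \<omega>) * indicator {\<omega>. t < \<nu> \<omega>} \<omega>"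
    by (rule I.real_cond_exp_cash_flow[of \<zeta>, unfolded \<nu>, OF \<zeta>_eq \<zeta>_measurable])
  then show ?thesis
  proof eventually_elim
    case (elim \<omega>)
    then show ?case
      unfolding sum I.q_def by (simp only: distrib_left mult.assoc)
  qed
qed

end
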